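(* Let $V$ be a simply-connected globally hyperbolic conformally flat spacetime of dimension $n\ge 3$, and let $E(V)\to\mathcal{B}$ be its enveloping space, identified with $\mathcal{B}\times\mathbb{R}$ by its global trivialization. Any causally convex globally hyperbolic open subset $\Omega$ of $E(V)$ without conjugate points is the domain bounded by the graphs of two $1$-Lipschitz real-valued functions $f^+$ and $f^-$ defined on an open subset $U$ of $\mathcal{B}$, i.e. $\Omega=\{(x,t)\in U\times\mathbb{R}: f^-(x)<t<f^+(x)\}$, such that: (1) $f^-<f^+$ on $U$; (2) the extensions of $f^+$ and $f^-$ to $\partial U$ coincide.
   Context: A spacetime is an oriented, time-oriented Lorentzian manifold; conformally flat means locally conformal to Minkowski spacetime. A subset is causally convex if it contains every causal curve of the ambient spacetime joining two of its points. Globally hyperbolic: strongly causal (every neighborhood of every point contains a causally convex neighborhood of that point) with all $J^-(p)\cap J^+(q)$ compact. $\widetilde{Ein}_{1,n-1}$ (universal cover of the Einstein universe) is conformally $\mathbb{S}^{n-1}\times\mathbb{R}$ with the conformal class of $d\sigma^2-dt^2$ ($d\sigma^2$ the round metric), time-oriented by $\partial_t$; fix such an identification (spatio-temporal decomposition) and let $\pi:\widetilde{Ein}_{1,n-1}\to\mathbb{S}^{n-1}$ be the projection. Two points of $\widetilde{Ein}_{1,n-1}$ are conjugate if one is the image of the other under $\sigma(x,t)=(-x,t+\pi)$ (here $\pi$ is the number). Enveloping space. Let $D:V\to\widetilde{Ein}_{1,n-1}$ be a developing map (a local conformal diffeomorphism). The pull-back by $D$ of $\partial_t$ defines a foliation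 of $V$ by timelike curves; let $\psi:V\to\mathcal{B}$ be the projection to its leaf space, which is homeomorphic to a Cauchy hypersurface of $V$. The map $\pi\circ D$ induces a local homeomorphism $d:\mathcal{B}\to\mathbb{S}^{n-1}$ with $d\circ\psi=\pi\circ D$. Then $E(V)=\{(p,b)\in\widetilde{Ein}_{1,n-1}\times\mathcal{B}:\pi(p)=d(b)\}$, with the conformally flat spacetime structure pulled back by the local homeomorphism $\hat D:E(V)\to\widetilde{Ein}_{1,n-1}$, $(p,b)\mapsto p$. The global trivialization $\mathcal{B}\times\mathbb{R}\cong E(V)$ sends $(b,t)$ to $((d(b),t),b)$. Two points of $E(V)$ are conjugate if their images under $\hat D$ are conjugate. A real-valued function $f$ on an open subset $U\subset\mathcal{B}$ is called $1$-Lipschitz if every $x\in U$ has an open neighborhood $U_x\subset U$ such that $d|_{U_x}$ is injective and $f\circ (d|_{U_x})^{-1}:d(U_x)\subset\mathbb{S}^{n-1}\to\mathbb{R}$ is $1$-Lipschitz for the round distance. Extensions to $\partial U$ are continuous extensions. *)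

theory Defs
  imports "HOL-Analysis.Analysis"
begin

section \<open>Smooth maps, charts and Lorentzian metrics\<close>

text \<open>Only meaningful for open \<open>S\<close>: continuity of all iterated directional derivatives
  of order at most \<open>k\<close>.\<close>

primrec Ck_on :: "nat \<Rightarrow> 'a::euclidean_space set \<Rightarrow> ('a \<Rightarrow> 'b::real_normed_vector) \<Rightarrow> bool" where
  "Ck_on 0 S f \<longleftrightarrow> continuous_on S f"
| "Ck_on (Suc k) S f \<longleftrightarrow>
     (\<forall>x\<in>S. f differentiable (at x)) \<and> (\<forall>v. Ck_on k S (\<lambda>x. frechet_derivative f (at x) v))"

definition smooth_on :: "'a::euclidean_space set \<Rightarrow> ('a \<Rightarrow> 'b::real_normed_vector) \<Rightarrow> bool" where
  "smooth_on S f \<longleftrightarrow> (\<forall>k. Ck_on k S f)"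

text \<open>A manifold is the whole of a (Hausdorff, second countable) type \<open>'v\<close> together with an atlas.
  A chart is a pair of a domain and a coordinate map; the map is irrelevant outside the domain.\<close>

type_synonym ('v, 'n) chart = "'v set \<times> ('v \<Rightarrow> real ^ 'n)"

definition is_chart :: "('v::topological_space, 'n::finite) chart \<Rightarrow> bool" where
  "is_chart c \<longleftrightarrow> open (fst c) \<and> open (snd c ` fst c) \<and>
     homeomorphism (fst c) (snd c ` fst c) (snd c) (inv_into (fst c) (snd c))"

definition overlap :: "('v, 'n) chart \<Rightarrow> 'v set \<Rightarrow> (real ^ 'n) set" where
  "overlap c W = snd c ` (fst c \<inter> W)"

definition in_chart :: "('v, 'n) chart \<Rightarrow> ('v \<Rightarrow> 'b) \<Rightarrow> real ^ 'n \<Rightarrow> 'b" where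
  "in_chart c F = F \<circ> inv_into (fst c) (snd c)"

definition oriented_atlas :: "('v::topological_space, 'n::finite) chart set \<Rightarrow> bool" where
  "oriented_atlas A \<longleftrightarrow>
     (\<forall>c\<in>A. is_chart c) \<and> (\<Union>c\<in>A. fst c) = UNIV \<and>
     (\<forall>c\<in>A. \<forall>c'\<in>A. smooth_on (overlap c (fst c')) (in_chart c (snd c')) \<and>
        (\<forall>x\<in>overlap c (fst c').
           det (matrix (frechet_derivative (in_chart c (snd c')) (at x))) > 0))"

text \<open>Minkowski space is \<open>real ^ 'n\<close> with one (arbitrarily chosen) coordinate as time;
  all choices are isometric.\<close>

definition time_index :: "'n::finite" where
  "time_index = (SOME i. True)"

definition minkowski :: "real ^ 'n::finite \<Rightarrow> real ^ 'n \<Rightarrow> real" where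
  "minkowski u v = u \<bullet> v - 2 * (u $ time_index) * (v $ time_index)"

definition lorentzian_form :: "(real ^ 'n::finite \<Rightarrow> real ^ 'n \<Rightarrow> real) \<Rightarrow> bool" where
  "lorentzian_form q \<longleftrightarrow>
     (\<exists>P :: real ^ 'n \<Rightarrow> real ^ 'n. linear P \<and> bij P \<and> (\<forall>u v. q u v = minkowski (P u) (P v)))"

text \<open>Tensors are given by their coordinate expressions: \<open>g c x\<close> is the metric at the point with
  coordinates \<open>x\<close> in the chart \<open>c\<close>, subject to the transformation law of a (0,2)-tensor.\<close>

type_synonym ('v, 'n) metric =
  "('v, 'n) chart \<Rightarrow> real ^ 'n \<Rightarrow> real ^ 'n \<Rightarrow> real ^ 'n \<Rightarrow> real"

type_synonym ('v, 'n) vector_field = "('v, 'n) chart \<Rightarrow> real ^ 'n \<Rightarrow> real ^ 'n"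

definition lorentzian_metric ::
    "('v::topological_space, 'n::finite) chart set \<Rightarrow> ('v, 'n) metric \<Rightarrow> bool" where
  "lorentzian_metric A g \<longleftrightarrow>
     (\<forall>c\<in>A. (\<forall>x\<in>snd c ` fst c. lorentzian_form (g c x)) \<and>
             (\<forall>u v. smooth_on (snd c ` fst c) (\<lambda>x. g c x u v))) \<and>
     (\<forall>c\<in>A. \<forall>c'\<in>A. \<forall>x\<in>overlap c (fst c'). \<forall>u v.
        g c x u v = g c' (in_chart c (snd c') x)
          (frechet_derivative (in_chart c (snd c')) (at x) u)
          (frechet_derivative (in_chart c (snd c')) (at x) v))"

text \<open>A time orientation is represented by a continuous timelike vector field \<open>X\<close>.\<close>

definition time_orientation ::
    "('v::topological_space, 'n::finite) chart set \<Rightarrow> ('v, 'n) metric \<Rightarrow> ('v, 'n) vector_field \<Rightarrow> bool"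
  where
  "time_orientation A g X \<longleftrightarrow>
     (\<forall>c\<in>A. continuous_on (snd c ` fst c) (X c) \<and>
             (\<forall>x\<in>snd c ` fst c. g c x (X c x) (X c x) < 0)) \<and>
     (\<forall>c\<in>A. \<forall>c'\<in>A. \<forall>x\<in>overlap c (fst c').
        X c' (in_chart c (snd c') x) = frechet_derivative (in_chart c (snd c')) (at x) (X c x))"

definition spacetime ::
    "('v::{t2_space,second_countable_topology}, 'n::finite) chart set \<Rightarrow> ('v, 'n) metric \<Rightarrow>
     ('v, 'n) vector_field \<Rightarrow> bool" where
  "spacetime A g X \<longleftrightarrow> oriented_atlas A \<and> lorentzian_metric A g \<and> time_orientation A g X"


section \<open>Conformal maps\<close>

text \<open>\<open>F\<close> restricts to a conformal diffeomorphism from the open set \<open>W\<close> onto an open subset of the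
  submanifold \<open>M\<close> of a vector space, where \<open>M\<close> carries the restriction of the bilinear form \<open>q\<close>.
  For \<open>M\<close> of the same dimension as \<open>W\<close>, smoothness of the inverse is automatic, since the
  derivative of \<open>F\<close> is injective by non-degeneracy of \<open>g\<close>.\<close>

definition conformal_diffeo_on ::
    "('v::topological_space, 'n::finite) chart set \<Rightarrow> ('v, 'n) metric \<Rightarrow> 'v set \<Rightarrow>
     ('v \<Rightarrow> 'b::real_normed_vector) \<Rightarrow> 'b set \<Rightarrow> ('b \<Rightarrow> 'b \<Rightarrow> real) \<Rightarrow> bool" where
  "conformal_diffeo_on A g W F M q \<longleftrightarrow>
     homeomorphism W (F ` W) F (inv_into W F) \<and> openin (top_of_set M) (F ` W) \<and>
     (\<forall>c\<in>A. smooth_on (overlap c W) (in_chart c F) \<and>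
        (\<forall>x\<in>overlap c W. \<exists>l>0. \<forall>u v.
           q (frechet_derivative (in_chart c F) (at x) u)
             (frechet_derivative (in_chart c F) (at x) v) = l * g c x u v))"

definition conformally_flat ::
    "('v::topological_space, 'n::finite) chart set \<Rightarrow> ('v, 'n) metric \<Rightarrow> bool" where
  "conformally_flat A g \<longleftrightarrow>
     (\<forall>p. \<exists>W. \<exists>F :: 'v \<Rightarrow> real ^ 'n. open W \<and> p \<in> W \<and>
        conformal_diffeo_on A g W F UNIV minkowski)"


section \<open>Causality\<close>

text \<open>The causal structure of a spacetime is given by its topology and by the predicate
  \<open>C \<gamma> a b\<close> saying that \<open>\<gamma>\<close> restricted to \<open>{a..b}\<close> is a future-directed causal curve.\<close>

type_synonym 'x curves = "(real \<Rightarrow> 'x) \<Rightarrow> real \<Rightarrow> real \<Rightarrow> bool"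

definition piecewise :: "'x curves \<Rightarrow> 'x curves" where
  "piecewise C \<gamma> a b \<longleftrightarrow> a < b \<and>
     (\<exists>S. finite S \<and> {a, b} \<subseteq> S \<and> S \<subseteq> {a..b} \<and>
        (\<forall>u\<in>S. \<forall>v\<in>S. u < v \<and> S \<inter> {u<..<v} = {} \<longrightarrow> C \<gamma> u v))"

definition causal_future :: "'x topology \<Rightarrow> 'x curves \<Rightarrow> 'x \<Rightarrow> 'x set" where
  "causal_future T C p =
     {q \<in> topspace T. q = p \<or> (\<exists>\<gamma> a b. C \<gamma> a b \<and> \<gamma> a = p \<and> \<gamma> b = q)}"

definition causal_past :: "'x topology \<Rightarrow> 'x curves \<Rightarrow> 'x \<Rightarrow> 'x set" where
  "causal_past T C p =
     {q \<in> topspace T. q = p \<or> (\<exists>\<gamma> a b. C \<gamma> a b \<and> \<gamma> a = q \<and> \<gamma> b = p)}"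

definition causally_convex :: "'x curves \<Rightarrow> 'x set \<Rightarrow> bool" where
  "causally_convex C S \<longleftrightarrow>
     (\<forall>\<gamma> a b. C \<gamma> a b \<and> \<gamma> a \<in> S \<and> \<gamma> b \<in> S \<longrightarrow> \<gamma> ` {a..b} \<subseteq> S)"

definition neighborhood :: "'x topology \<Rightarrow> 'x \<Rightarrow> 'x set \<Rightarrow> bool" where
  "neighborhood T p N \<longleftrightarrow> N \<subseteq> topspace T \<and> (\<exists>W. openin T W \<and> p \<in> W \<and> W \<subseteq> N)"

definition strongly_causal :: "'x topology \<Rightarrow> 'x curves \<Rightarrow> bool" where
  "strongly_causal T C \<longleftrightarrow>
     (\<forall>p\<in>topspace T. \<forall>N. neighborhood T p N \<longrightarrow>
        (\<exists>M. M \<subseteq> N \<and> neighborhood T p M \<and> causally_convex C M))"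

definition globally_hyperbolic :: "'x topology \<Rightarrow> 'x curves \<Rightarrow> bool" where
  "globally_hyperbolic T C \<longleftrightarrow> strongly_causal T C \<and>
     (\<forall>p\<in>topspace T. \<forall>q\<in>topspace T. compactin T (causal_past T C p \<inter> causal_future T C q))"

text \<open>The causal structure induced on a subset.\<close>

definition curves_in :: "'x set \<Rightarrow> 'x curves \<Rightarrow> 'x curves" where
  "curves_in S C \<gamma> a b \<longleftrightarrow> C \<gamma> a b \<and> \<gamma> ` {a..b} \<subseteq> S"

text \<open>Causal curves of a spacetime are piecewise continuously differentiable, with future-directed
  causal one-sided derivatives everywhere; \<open>w\<close> is the velocity read in the chart \<open>c\<close>.
  The signature is \<open>(- + ... +)\<close>, so a nonzero causal vector is future-directed iff its product
  with \<open>X\<close> is negative.\<close>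

definition C1_causal_curve ::
    "('v::topological_space, 'n::finite) chart set \<Rightarrow> ('v, 'n) metric \<Rightarrow> ('v, 'n) vector_field \<Rightarrow>
     'v curves" where
  "C1_causal_curve A g X \<gamma> a b \<longleftrightarrow> continuous_on {a..b} \<gamma> \<and>
     (\<forall>c\<in>A. \<exists>w. continuous_on {s \<in> {a..b}. \<gamma> s \<in> fst c} w \<and>
        (\<forall>s\<in>{a..b}. \<gamma> s \<in> fst c \<longrightarrow>
           ((snd c \<circ> \<gamma>) has_vector_derivative w s) (at s within {a..b}) \<and>
           w s \<noteq> 0 \<and> g c (snd c (\<gamma> s)) (w s) (w s) \<le> 0 \<and>
           g c (snd c (\<gamma> s)) (w s) (X c (snd c (\<gamma> s))) < 0))"

definition causal_curve ::
    "('v::topological_space, 'n::finite) chart set \<Rightarrow> ('v, 'n) metric \<Rightarrow> ('v, 'n) vector_field \<Rightarrow>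
     'v curves" where
  "causal_curve A g X = piecewise (C1_causal_curve A g X)"


section \<open>The universal cover of the Einstein universe\<close>

text \<open>With \<open>n = CARD('n) \<ge> 3\<close>, this is \<open>S\<^sup>n\<^sup>-\<^sup>1 \<times> \<real>\<close>, embedded in \<open>\<real>\<^sup>n \<times> \<real>\<close>; the metric
  \<open>d\<sigma>\<^sup>2 - dt\<^sup>2\<close> is the restriction of \<open>ein_form\<close>.\<close>

definition Ein :: "((real ^ 'n::finite) \<times> real) set" where
  "Ein = sphere 0 1 \<times> UNIV"

definition ein_form :: "(real ^ 'n::finite) \<times> real \<Rightarrow> (real ^ 'n) \<times> real \<Rightarrow> real" where
  "ein_form u v = fst u \<bullet> fst v - snd u * snd v"

text \<open>The time orientation is given by \<open>\<partial>\<^sub>t = (0, 1)\<close>.\<close>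

definition C1_ein_causal_curve :: "((real ^ 'n::finite) \<times> real) curves" where
  "C1_ein_causal_curve \<gamma> a b \<longleftrightarrow> \<gamma> ` {a..b} \<subseteq> Ein \<and>
     (\<exists>w. continuous_on {a..b} w \<and>
        (\<forall>s\<in>{a..b}. (\<gamma> has_vector_derivative w s) (at s within {a..b}) \<and>
           w s \<noteq> 0 \<and> ein_form (w s) (w s) \<le> 0 \<and> ein_form (w s) (0, 1) < 0))"

definition ein_causal_curve :: "((real ^ 'n::finite) \<times> real) curves" where
  "ein_causal_curve = piecewise C1_ein_causal_curve"

definition ein_conjugation :: "(real ^ 'n::finite) \<times> real \<Rightarrow> (real ^ 'n) \<times> real" where
  "ein_conjugation p = (- fst p, snd p + pi)"

definition ein_conjugate :: "(real ^ 'n::finite) \<times> real \<Rightarrow> (real ^ 'n) \<times> real \<Rightarrow> bool" where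
  "ein_conjugate p q \<longleftrightarrow> q = ein_conjugation p \<or> p = ein_conjugation q"

definition developing_map ::
    "('v::topological_space, 'n::finite) chart set \<Rightarrow> ('v, 'n) metric \<Rightarrow>
     ('v \<Rightarrow> (real ^ 'n) \<times> real) \<Rightarrow> bool" where
  "developing_map A g D \<longleftrightarrow>
     (\<forall>p. \<exists>W. open W \<and> p \<in> W \<and> conformal_diffeo_on A g W D Ein ein_form)"


section \<open>The enveloping space\<close>

text \<open>Two points lie on the same leaf iff they lie on a common integral curve of \<open>D\<^sup>*\<partial>\<^sub>t\<close>, that is,
  on a continuous curve whose image under the local diffeomorphism \<open>D\<close> has velocity
  \<open>\<partial>\<^sub>t = (0, 1)\<close>.\<close>

definition leaf_rel :: "('v::topological_space \<Rightarrow> (real ^ 'n::finite) \<times> real) \<Rightarrow> ('v \<times> 'v) set" where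
  "leaf_rel D = {(x, y). \<exists>\<gamma> a b. continuous_on {a..b} \<gamma> \<and>
     (\<forall>s\<in>{a..b}. ((D \<circ> \<gamma>) has_vector_derivative (0, 1)) (at s within {a..b})) \<and>
     x \<in> \<gamma> ` {a..b} \<and> y \<in> \<gamma> ` {a..b}}"

definition leaf_proj :: "('v::topological_space \<Rightarrow> (real ^ 'n::finite) \<times> real) \<Rightarrow> 'v \<Rightarrow> 'v set" where
  "leaf_proj D x = leaf_rel D `` {x}"

definition leaf_space :: "('v::topological_space \<Rightarrow> (real ^ 'n::finite) \<times> real) \<Rightarrow> 'v set topology" where
  "leaf_space D = topology (\<lambda>U. U \<subseteq> range (leaf_proj D) \<and> open (leaf_proj D -` U))"

lemma openin_leaf_space:
  "openin (leaf_space D) U \<longleftrightarrow> U \<subseteq> range (leaf_proj D) \<and> open (leaf_proj D -` U)"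
proof -
  have "istopology (\<lambda>U. U \<subseteq> range (leaf_proj D) \<and> open (leaf_proj D -` U))"
    unfolding istopology_def by (auto simp: vimage_Union)
  then show ?thesis
    unfolding leaf_space_def by simp
qed

lemma topspace_leaf_space: "topspace (leaf_space D) = range (leaf_proj D)"
  unfolding topspace_def openin_leaf_space by (auto simp: vimage_def)

lemma quotient_map_leaf_proj: "quotient_map euclidean (leaf_space D) (leaf_proj D)"
  unfolding quotient_map_def
  by (auto simp: topspace_leaf_space openin_leaf_space vimage_def)

text \<open>The map \<open>d\<close> characterized by \<open>d \<circ> leaf_proj D = fst \<circ> D\<close>.\<close>

definition leaf_dev :: "('v::topological_space \<Rightarrow> (real ^ 'n::finite) \<times> real) \<Rightarrow> 'v set \<Rightarrow> real ^ 'n" where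
  "leaf_dev D b = the_elem ((fst \<circ> D) ` b)"

definition env_space ::
    "('v::topological_space \<Rightarrow> (real ^ 'n::finite) \<times> real) \<Rightarrow> (((real ^ 'n) \<times> real) \<times> 'v set) topology"
  where
  "env_space D = subtopology (prod_topology (top_of_set Ein) (leaf_space D))
     {(p, b). fst p = leaf_dev D b}"

text \<open>The causal structure pulled back by the local homeomorphism \<open>fst : E(V) \<rightarrow> Ein\<close>.\<close>

definition env_causal_curve ::
    "('v::topological_space \<Rightarrow> (real ^ 'n::finite) \<times> real) \<Rightarrow> (((real ^ 'n) \<times> real) \<times> 'v set) curves"
  where
  "env_causal_curve D \<gamma> a b \<longleftrightarrow>
     continuous_map (top_of_set {a..b}) (env_space D) \<gamma> \<and> ein_causal_curve (fst \<circ> \<gamma>) a b"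

definition env_conjugate ::
    "((real ^ 'n::finite) \<times> real) \<times> 'v set \<Rightarrow> ((real ^ 'n) \<times> real) \<times> 'v set \<Rightarrow> bool" where
  "env_conjugate p q \<longleftrightarrow> ein_conjugate (fst p) (fst q)"

definition env_triv ::
    "('v::topological_space \<Rightarrow> (real ^ 'n::finite) \<times> real) \<Rightarrow> 'v set \<times> real \<Rightarrow>
     ((real ^ 'n) \<times> real) \<times> 'v set" where
  "env_triv D = (\<lambda>(b, t). ((leaf_dev D b, t), b))"

definition round_dist :: "real ^ 'n::finite \<Rightarrow> real ^ 'n \<Rightarrow> real" where
  "round_dist x y = arccos (x \<bullet> y)"

definition one_lipschitz ::
    "('v::topological_space \<Rightarrow> (real ^ 'n::finite) \<times> real) \<Rightarrow> 'v set set \<Rightarrow> ('v set \<Rightarrow> real) \<Rightarrow> bool"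
  where
  "one_lipschitz D U f \<longleftrightarrow>
     (\<forall>x\<in>U. \<exists>W. openin (leaf_space D) W \<and> x \<in> W \<and> W \<subseteq> U \<and> inj_on (leaf_dev D) W \<and>
        (\<forall>y\<in>leaf_dev D ` W. \<forall>z\<in>leaf_dev D ` W.
           \<bar>f (inv_into W (leaf_dev D) y) - f (inv_into W (leaf_dev D) z)\<bar> \<le> round_dist y z))"

definition continuous_extension :: "'x topology \<Rightarrow> 'x set \<Rightarrow> ('x \<Rightarrow> real) \<Rightarrow> ('x \<Rightarrow> real) \<Rightarrow> bool" where
  "continuous_extension T U f h \<longleftrightarrow>
     continuous_map (subtopology T (T closure_of U)) euclideanreal h \<and> (\<forall>x\<in>U. h x = f x)"

end

theory Submission
  imports Defs
begin

text \<open>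
  The flow along the leaves shows that the leaf space \<open>\<B>\<close> is locally homeomorphic to the sphere, by
  the map \<open>d\<close>; the space \<open>E(V)\<close> is \<open>\<B> \<times> \<real>\<close>, and inside a convex ball of \<open>\<B>\<close> a point \<open>(x, t)\<close> precedes
  \<open>(y, s)\<close> as soon as \<open>s - t\<close> is positive and not smaller than the distance of \<open>x\<close> and \<open>y\<close>. By causal
  convexity the fibres of \<open>\<Omega>\<close> over \<open>\<B>\<close> are open intervals. They have length at most \<open>2 * pi\<close>: the
  diamonds of a longer fibre over \<open>b\<close> are compact, so a great circle starting at \<open>d b\<close> lifts to \<open>\<B>\<close> up to
  \<open>- d b\<close> without leaving them, which gives two conjugate points of \<open>\<Omega>\<close>. The functions \<open>f\<^sup>+\<close> and
  \<open>f\<^sup>-\<close> are the suprema and infima of the fibres. Finally, if \<open>x\<close> is not below \<open>\<Omega>\<close>, then no diamond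
  between two points of \<open>\<Omega>\<close> contains a point over \<open>x\<close>; hence times of points of \<open>\<Omega>\<close> lying over
  the \<open>\<epsilon>\<close>-ball about \<open>x\<close> differ by at most \<open>2 * \<epsilon>\<close>, and \<open>f\<^sup>+\<close> and \<open>f\<^sup>-\<close> have a common limit at \<open>x\<close>.
\<close>

section \<open>Great circles\<close>

text \<open>For orthonormal \<open>u\<close> and \<open>e\<close> this is the unit-speed great
  circle leaving \<open>u\<close> with velocity \<open>e\<close>; its velocity is again such a
  circle, for \<open>e\<close> and \<open>- u\<close>.\<close>

definition great_circle :: "'a::real_inner \<Rightarrow> 'a \<Rightarrow> real \<Rightarrow> 'a" where
  "great_circle u e s = cos s *\<^sub>R u + sin s *\<^sub>R e"

lemma inner_great_circle:
  assumes "norm u = 1" "norm e = 1" "u \<bullet> e = 0"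
  shows "great_circle u e s \<bullet> great_circle u e r = cos (s - r)"
proof -
  have "u \<bullet> u = 1" "e \<bullet> e = 1" "e \<bullet> u = 0"
    using assms by (auto simp: dot_square_norm inner_commute)
  with assms show ?thesis
    by (simp add: great_circle_def inner_simps cos_diff)
qed

lemma norm_great_circle:
  assumes "norm u = 1" "norm e = 1" "u \<bullet> e = 0"
  shows "norm (great_circle u e s) = 1"
  using inner_great_circle[OF assms, of s s] by (simp add: norm_eq_sqrt_inner)

lemma has_vector_derivative_great_circle:
  "(great_circle u e has_vector_derivative great_circle e (- u) s) (at s)"
proof -
  have "((\<lambda>s. cos s *\<^sub>R u + sin s *\<^sub>R e) has_vector_derivative
      (cos s *\<^sub>R 0 + - sin s *\<^sub>R u) + (sin s *\<^sub>R 0 + cos s *\<^sub>R e)) (at s)"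
    by (intro has_vector_derivative_add has_vector_derivative_scaleR DERIV_cos DERIV_sin
        has_vector_derivative_const)
  then show ?thesis
    by (simp add: great_circle_def[abs_def])
qed

lemma continuous_on_great_circle: "continuous_on S (great_circle u e)"
  unfolding great_circle_def by (intro continuous_intros)

lemma dist_squared_sphere:
  fixes x y :: "'a::real_inner"
  assumes "norm x = 1" "norm y = 1"
  shows "(dist x y)\<^sup>2 = 2 - 2 * (x \<bullet> y)"
proof -
  have "(dist x y)\<^sup>2 = x \<bullet> x - 2 * (x \<bullet> y) + y \<bullet> y"
    by (simp add: dist_norm power2_norm_eq_inner inner_diff_left inner_diff_right inner_commute)
  then show ?thesis using assms by (simp add: dot_square_norm)
qed

text \<open>The chord between the parameters \<open>s\<close> and \<open>r\<close> has length
  \<open>2 * \<bar>sin ((s - r) / 2)\<bar>\<close>, and a sine is at most its argument in absolute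
  value.\<close>

lemma dist_great_circle_le:
  assumes "norm u = 1" "norm e = 1" "u \<bullet> e = 0"
  shows "dist (great_circle u e s) (great_circle u e r) \<le> \<bar>s - r\<bar>"
proof (rule power2_le_imp_le)
  let ?x = "great_circle u e s" and ?y = "great_circle u e r"
  have "(dist ?x ?y)\<^sup>2 = 2 - 2 * (?x \<bullet> ?y)"
    using dist_squared_sphere norm_great_circle[OF assms] by blast
  \<comment> \<open>The angle is written as a double so that the double angle formula produces a
    square.\<close>
  also have "\<dots> = 2 - 2 * cos (2 * ((s - r) / 2))"
  proof -
    have "2 * ((s - r) / 2) = s - r" by simp
    then show ?thesis by (simp only: inner_great_circle[OF assms])
  qed
  also have "\<dots> = (2 * sin ((s - r) / 2))\<^sup>2"
    by (simp only: cos_double_sin power_mult_distrib) simp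
  also have "\<dots> \<le> (2 * ((s - r) / 2))\<^sup>2"
    using abs_sin_x_le_abs_x[of "(s - r) / 2"] by (intro abs_le_square_iff[THEN iffD1]) simp
  also have "2 * ((s - r) / 2) = s - r" by simp
  finally show "(dist ?x ?y)\<^sup>2 \<le> \<bar>s - r\<bar>\<^sup>2" by simp
qed simp

text \<open>On the unit sphere a ball is a cap cut out by a half-space, so membership becomes a
  linear condition on \<open>y\<close>.\<close>

lemma mem_sphere_ball_iff_inner:
  fixes x y :: "'a::real_inner"
  assumes "norm x = 1" "norm y = 1" "0 < r"
  shows "y \<in> ball x r \<longleftrightarrow> 1 - r\<^sup>2 / 2 < x \<bullet> y"
proof -
  have "(dist x y)\<^sup>2 = 2 - 2 * (x \<bullet> y)"
    using assms(1,2) by (rule dist_squared_sphere)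
  moreover have "dist x y < r \<longleftrightarrow> (dist x y)\<^sup>2 < r\<^sup>2"
    using \<open>0 < r\<close> by (metis power2_less_imp_less power_strict_mono zero_le_dist less_imp_le zero_less_numeral)
  ultimately show ?thesis by auto
qed

lemma sphere_eqI:
  fixes x y :: "'a::real_inner"
  assumes "norm x = 1" "norm y = 1" "x \<bullet> y = 1"
  shows "x = y"
proof -
  have "(dist x y)\<^sup>2 = 0"
    using dist_squared_sphere[OF assms(1,2)] assms(3) by simp
  then show ?thesis by simp
qed

text \<open>The shortest arc, parametrised by its length. Antipodal endpoints are excluded because
  they leave the direction of the arc undetermined. The speed is only bounded by 1, which admits the
  constant curve for \<open>u = v\<close>. The last clause lets \<open>sphere_ball_convex\<close>
  keep the arc inside a ball.\<close>

lemma great_arc: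
  fixes u v :: "'a::real_inner"
  assumes u: "norm u = 1" and v: "norm v = 1" and uv: "- 1 < u \<bullet> v"
  obtains \<sigma> \<sigma>' where "\<And>s. (\<sigma> has_vector_derivative \<sigma>' s) (at s)" "continuous_on UNIV \<sigma>'"
    "\<And>s. norm (\<sigma>' s) \<le> 1" "\<And>s. norm (\<sigma> s) = 1" "\<sigma> 0 = u" "\<sigma> (arccos (u \<bullet> v)) = v"
    "\<And>s. s \<in> {0..arccos (u \<bullet> v)} \<Longrightarrow> \<exists>\<alpha> \<beta>. 0 \<le> \<alpha> \<and> 0 \<le> \<beta> \<and> \<sigma> s = \<alpha> *\<^sub>R u + \<beta> *\<^sub>R v"
proof (cases "u \<bullet> v = 1")
  case True
  then have "u = v" using sphere_eqI u v by blast
  show ?thesis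
  proof (rule that[of "\<lambda>_. u" "\<lambda>_. 0"])
    show "\<exists>\<alpha> \<beta>. 0 \<le> \<alpha> \<and> 0 \<le> \<beta> \<and> u = \<alpha> *\<^sub>R u + \<beta> *\<^sub>R v" for s :: real
      by (rule exI[of _ 1], rule exI[of _ 0]) simp
  qed (use u \<open>u = v\<close> in auto)
next
  case False
  define \<theta> where "\<theta> = arccos (u \<bullet> v)"
  have "u \<bullet> v \<le> 1" using norm_cauchy_schwarz[of u v] u v by simp
  then have uv1: "u \<bullet> v < 1" using False by simp
  then have \<theta>: "0 < \<theta>" "\<theta> < pi" and cos: "cos \<theta> = u \<bullet> v"
    using uv arccos_lt_bounded[of "u \<bullet> v"] by (auto simp: \<theta>_def cos_arccos)
  have sin: "0 < sin \<theta>" using \<theta> by (simp add: sin_gt_zero)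
  \<comment> \<open>Gram-Schmidt: the component of \<open>v\<close> orthogonal to \<open>u\<close>
    has norm \<open>sin \<theta>\<close>.\<close>
  define e where "e = (1 / sin \<theta>) *\<^sub>R (v - cos \<theta> *\<^sub>R u)"
  have ue: "u \<bullet> e = 0" using u by (simp add: e_def inner_simps cos dot_square_norm)
  have "(v - cos \<theta> *\<^sub>R u) \<bullet> (v - cos \<theta> *\<^sub>R u)
      = v \<bullet> v - 2 * cos \<theta> * (u \<bullet> v) + (cos \<theta>)\<^sup>2 * (u \<bullet> u)"
    by (simp add: inner_diff_left inner_diff_right inner_commute power2_eq_square)
  also have "\<dots> = (sin \<theta>)\<^sup>2"
    using u v by (simp add: dot_square_norm sin_squared_eq flip: cos) (simp add: power2_eq_square)
  finally have "(v - cos \<theta> *\<^sub>R u) \<bullet> (v - cos \<theta> *\<^sub>R u) = (sin \<theta>)\<^sup>2" .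
  then have e: "norm e = 1" using sin by (simp add: e_def norm_eq_sqrt_inner power2_eq_square)
  show ?thesis
  proof (rule that[of "great_circle u e" "great_circle e (- u)"])
    show "norm (great_circle e (- u) s) \<le> 1" for s
      using norm_great_circle[of e "- u"] u e ue by (simp add: inner_commute)
    show "norm (great_circle u e s) = 1" for s
      using norm_great_circle u e ue by blast
    show "continuous_on UNIV (great_circle e (- u))"
      by (rule continuous_on_great_circle)
    show "great_circle u e (arccos (u \<bullet> v)) = v"
      using sin by (simp add: great_circle_def e_def flip: \<theta>_def)
    fix s assume s: "s \<in> {0..arccos (u \<bullet> v)}"
    \<comment> \<open>Spherical linear interpolation; the coefficients are nonnegative because
      \<open>s\<close> and \<open>\<theta> - s\<close> lie between 0 and \<open>pi\<close>.\<close>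
    have "great_circle u e s = (sin (\<theta> - s) / sin \<theta>) *\<^sub>R u + (sin s / sin \<theta>) *\<^sub>R v"
    proof -
      have "sin (\<theta> - s) / sin \<theta> = cos s - sin s * cos \<theta> / sin \<theta>"
        using sin by (simp add: sin_diff diff_divide_distrib mult.commute)
      then show ?thesis
        by (simp add: great_circle_def e_def scaleR_diff_left scaleR_diff_right)
    qed
    moreover have "0 \<le> sin (\<theta> - s)" "0 \<le> sin s"
      using s \<theta> by (auto simp: \<theta>_def[symmetric] intro!: sin_ge_zero)
    ultimately show "\<exists>\<alpha> \<beta>. 0 \<le> \<alpha> \<and> 0 \<le> \<beta> \<and> great_circle u e s = \<alpha> *\<^sub>R u + \<beta> *\<^sub>R v"
      using sin by (meson divide_nonneg_pos)
  qed (auto intro: has_vector_derivative_great_circle simp: great_circle_def[of _ _ 0])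
qed

text \<open>The ball is the cap \<open>c < x \<bullet> w\<close>, where \<open>0 < c\<close> because
  \<open>r \<le> 1\<close>. A unit vector that is a nonnegative combination of unit vectors has
  \<open>1 \<le> \<alpha> + \<beta>\<close> by the triangle inequality, so the linear form stays
  above \<open>c * (\<alpha> + \<beta>)\<close>, hence above \<open>c\<close>.\<close>

lemma sphere_ball_convex:
  fixes u v w :: "'a::real_inner"
  assumes x: "norm x = 1" and r: "0 < r" "r \<le> 1"
    and u: "norm u = 1" "u \<in> ball x r" and v: "norm v = 1" "v \<in> ball x r"
    and w: "norm w = 1" "w = \<alpha> *\<^sub>R u + \<beta> *\<^sub>R v" and pos: "0 \<le> \<alpha>" "0 \<le> \<beta>"
  shows "w \<in> ball x r"
proof -
  define c where "c = 1 - r\<^sup>2 / 2"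
  have "r\<^sup>2 \<le> 1" using r by (simp add: power_le_one)
  then have c: "0 < c" by (simp add: c_def)
  have xu: "c < x \<bullet> u" and xv: "c < x \<bullet> v"
    using mem_sphere_ball_iff_inner[OF x _ r(1)] u v by (auto simp: c_def)
  have "1 \<le> norm (\<alpha> *\<^sub>R u) + norm (\<beta> *\<^sub>R v)"
    using norm_triangle_ineq[of "\<alpha> *\<^sub>R u" "\<beta> *\<^sub>R v"] w by simp
  then have ab: "1 \<le> \<alpha> + \<beta>" using u v pos by simp
  have "c \<le> c * (\<alpha> + \<beta>)" using c ab by simp
  also have "\<dots> < \<alpha> * (x \<bullet> u) + \<beta> * (x \<bullet> v)"
  \<comment> \<open>Strictness needs a positive coefficient; if \<open>\<alpha>\<close> vanishes,
    \<open>\<beta>\<close> is at least 1.\<close>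
  proof (cases "\<alpha> = 0")
    case True
    then show ?thesis using ab xv by (simp add: mult.commute[of c])
  next
    case False
    then have "\<alpha> * c < \<alpha> * (x \<bullet> u)" "\<beta> * c \<le> \<beta> * (x \<bullet> v)"
      using pos xu xv by (auto intro: mult_left_mono)
    then show ?thesis by (simp add: algebra_simps)
  qed
  also have "\<dots> = x \<bullet> w" by (simp add: w inner_simps)
  finally show ?thesis
    using mem_sphere_ball_iff_inner[OF x w(1) r(1)] by (simp add: c_def)
qed

text \<open>Points of a ball of radius at most 1 are less than 2 apart, hence not antipodal, as
  \<open>great_arc\<close> requires.\<close>

lemma sphere_ball_inner_pos:
  fixes u v x :: "'a::real_inner"
  assumes "norm x = 1" "0 < r" "r \<le> 1" "norm u = 1" "u \<in> ball x r" "norm v = 1" "v \<in> ball x r"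
  shows "- 1 < u \<bullet> v"
proof -
  have "dist u v < 2" using assms dist_triangle3[of u v x] by simp
  then have "v \<in> ball u 2" by simp
  then show ?thesis using mem_sphere_ball_iff_inner[of u v 2] assms by simp
qed

section \<open>The round distance\<close>

lemma round_dist_commute: "round_dist x y = round_dist y x"
  by (simp add: round_dist_def inner_commute)

lemma abs_inner_sphere_le: "norm x = 1 \<Longrightarrow> norm y = 1 \<Longrightarrow> \<bar>x \<bullet> y\<bar> \<le> 1"
  using Cauchy_Schwarz_ineq2[of x y] by simp

lemma round_dist_nonneg: "norm x = 1 \<Longrightarrow> norm y = 1 \<Longrightarrow> 0 \<le> round_dist x y"
  using abs_inner_sphere_le[of x y] unfolding round_dist_def by (intro arccos_lbound) auto

lemma round_dist_self: "norm x = 1 \<Longrightarrow> round_dist x x = 0"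
  by (simp add: round_dist_def dot_square_norm)

lemma round_dist_great_circle:
  assumes "norm u = 1" "norm e = 1" "u \<bullet> e = 0" "s \<le> r" "r - s \<le> pi"
  shows "round_dist (great_circle u e s) (great_circle u e r) = r - s"
  using assms(4,5) inner_great_circle[OF assms(1-3), of s r]
  by (simp add: round_dist_def arccos_cos cos_diff[of s r] cos_diff[of r s, symmetric] mult.commute)

section \<open>Causal curves\<close>

lemma piecewise_single: "C \<gamma> a b \<Longrightarrow> a < b \<Longrightarrow> piecewise C \<gamma> a b"
  unfolding piecewise_def by (intro conjI exI[of _ "{a, b}"]) auto

text \<open>Both subdivisions contain \<open>b\<close>, so no pair of neighbouring points of their
  union straddles \<open>b\<close>, and each pair comes from one of them.\<close>

lemma piecewise_concat:
  assumes "piecewise C \<gamma> a b" "piecewise C \<gamma> b c"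
  shows "piecewise C \<gamma> a c"
proof -
  obtain S where S: "a < b" "finite S" "{a, b} \<subseteq> S" "S \<subseteq> {a..b}"
    "\<forall>u\<in>S. \<forall>v\<in>S. u < v \<and> S \<inter> {u<..<v} = {} \<longrightarrow> C \<gamma> u v"
    using assms(1) unfolding piecewise_def by blast
  obtain T where T: "b < c" "finite T" "{b, c} \<subseteq> T" "T \<subseteq> {b..c}"
    "\<forall>u\<in>T. \<forall>v\<in>T. u < v \<and> T \<inter> {u<..<v} = {} \<longrightarrow> C \<gamma> u v"
    using assms(2) unfolding piecewise_def by blast
  have "C \<gamma> u v" if uv: "u \<in> S \<union> T" "v \<in> S \<union> T" "u < v" "(S \<union> T) \<inter> {u<..<v} = {}" for u v
  proof (cases "v \<le> b")
    case True
    then have "u \<in> S" "v \<in> S" using uv S T by fastforce+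
    then show ?thesis using S(5) uv by blast
  next
    case False
    then have "b \<le> u" using uv S(3) by fastforce
    then have "u \<in> T" "v \<in> T" using uv S T False by fastforce+
    then show ?thesis using T(5) uv by blast
  qed
  moreover have "S \<union> T \<subseteq> {a..c}" using S T by fastforce
  ultimately show ?thesis
    unfolding piecewise_def using S T by (intro conjI exI[of _ "S \<union> T"]) auto
qed

lemma piecewise_cong:
  assumes "piecewise C \<gamma> a b"
    and "\<And>u v. C \<gamma> u v \<Longrightarrow> a \<le> u \<Longrightarrow> v \<le> b \<Longrightarrow> C \<delta> u v"
  shows "piecewise C \<delta> a b"
proof -
  obtain S where S: "a < b" "finite S" "{a, b} \<subseteq> S" "S \<subseteq> {a..b}"
    "\<forall>u\<in>S. \<forall>v\<in>S. u < v \<and> S \<inter> {u<..<v} = {} \<longrightarrow> C \<gamma> u v"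
    using assms(1) unfolding piecewise_def by blast
  have "C \<delta> u v" if "u \<in> S" "v \<in> S" "u < v" "S \<inter> {u<..<v} = {}" for u v
    using assms(2) S(4,5) that by fastforce
  then show ?thesis
    unfolding piecewise_def using S by blast
qed

lemma piecewise_shift:
  assumes "piecewise C \<gamma> a b" and "\<And>u v. C \<gamma> u v \<Longrightarrow> C \<delta> (u + k) (v + k)"
  shows "piecewise C \<delta> (a + k) (b + k)"
proof -
  obtain S where S: "a < b" "finite S" "{a, b} \<subseteq> S" "S \<subseteq> {a..b}"
    "\<forall>u\<in>S. \<forall>v\<in>S. u < v \<and> S \<inter> {u<..<v} = {} \<longrightarrow> C \<gamma> u v"
    using assms(1) unfolding piecewise_def by blast
  have "C \<delta> (u + k) (v + k)"
    if "u \<in> S" "v \<in> S" "u < v" "(\<lambda>s. s + k) ` S \<inter> {u + k<..<v + k} = {}" for u v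
  proof -
    have "S \<inter> {u<..<v} = {}" using that(4) by auto
    then show ?thesis using assms(2) S(5) that by blast
  qed
  then show ?thesis
    unfolding piecewise_def using S by (intro conjI exI[of _ "(\<lambda>s. s + k) ` S"]) auto
qed

section \<open>Operations on causal curves of the Einstein universe\<close>

lemma C1_ein_causal_curve_cong:
  assumes "C1_ein_causal_curve \<gamma> a b" and eq: "\<And>s. s \<in> {a..b} \<Longrightarrow> \<delta> s = \<gamma> s"
  shows "C1_ein_causal_curve \<delta> a b"
proof -
  obtain w where w: "\<gamma> ` {a..b} \<subseteq> Ein" "continuous_on {a..b} w"
    "\<forall>s\<in>{a..b}. (\<gamma> has_vector_derivative w s) (at s within {a..b}) \<and>
           w s \<noteq> 0 \<and> ein_form (w s) (w s) \<le> 0 \<and> ein_form (w s) (0, 1) < 0"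
    using assms(1) unfolding C1_ein_causal_curve_def by blast
  have "(\<delta> has_vector_derivative w s) (at s within {a..b})" if "s \<in> {a..b}" for s
    using has_vector_derivative_transform[of s "{a..b}" \<delta> \<gamma>] w(3) that eq by blast
  moreover have "\<delta> ` {a..b} = \<gamma> ` {a..b}" using eq by (rule image_cong[OF refl])
  ultimately show ?thesis
    unfolding C1_ein_causal_curve_def using w by (intro conjI exI[of _ w]) simp_all
qed

lemma C1_ein_causal_curve_shift:
  assumes "C1_ein_causal_curve \<gamma> a b"
  shows "C1_ein_causal_curve (\<lambda>s. \<gamma> (s - k)) (a + k) (b + k)"
proof -
  have im: "(\<lambda>s. s - k) ` {a + k..b + k} = {a..b}"
    by (simp add: image_diff_atLeastAtMost)
  obtain w where w: "\<gamma> ` {a..b} \<subseteq> Ein" "continuous_on {a..b} w"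
    "\<forall>s\<in>{a..b}. (\<gamma> has_vector_derivative w s) (at s within {a..b}) \<and>
           w s \<noteq> 0 \<and> ein_form (w s) (w s) \<le> 0 \<and> ein_form (w s) (0, 1) < 0"
    using assms unfolding C1_ein_causal_curve_def by blast
  have "((\<lambda>s. \<gamma> (s - k)) has_vector_derivative w (s - k)) (at s within {a + k..b + k})"
    if "s \<in> {a + k..b + k}" for s
  proof -
    have "((\<lambda>s. s - k) has_vector_derivative 1) (at s within {a + k..b + k})"
      by (auto intro!: derivative_eq_intros)
    moreover have "(\<gamma> has_vector_derivative w (s - k)) (at (s - k) within (\<lambda>s. s - k) ` {a + k..b + k})"
      using w(3) that by (simp add: im)
    ultimately show ?thesis
      using vector_diff_chain_within by (fastforce simp: o_def)
  qed
  moreover have "continuous_on {a + k..b + k} (\<lambda>s. w (s - k))"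
    by (rule continuous_on_compose2[OF w(2)]) (auto intro!: continuous_intros)
  moreover have "(\<lambda>s. \<gamma> (s - k)) ` {a + k..b + k} \<subseteq> Ein"
    using w(1) by (auto simp: image_subset_iff)
  ultimately show ?thesis
    unfolding C1_ein_causal_curve_def using w(3) by (intro conjI exI[of _ "\<lambda>s. w (s - k)"]) auto
qed

lemma ein_causal_curve_cong:
  assumes "ein_causal_curve \<gamma> a b" "\<And>s. s \<in> {a..b} \<Longrightarrow> \<delta> s = \<gamma> s"
  shows "ein_causal_curve \<delta> a b"
  unfolding ein_causal_curve_def
proof (rule piecewise_cong)
  show "piecewise C1_ein_causal_curve \<gamma> a b" using assms by (simp add: ein_causal_curve_def)
  show "C1_ein_causal_curve \<delta> u v" if "C1_ein_causal_curve \<gamma> u v" "a \<le> u" "v \<le> b" for u v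
    using that assms(2) by (intro C1_ein_causal_curve_cong[of \<gamma> u v \<delta>]) auto
qed

lemma ein_causal_curve_shift:
  assumes "ein_causal_curve \<gamma> a b"
  shows "ein_causal_curve (\<lambda>s. \<gamma> (s - k)) (a + k) (b + k)"
  using assms unfolding ein_causal_curve_def
  by (rule piecewise_shift) (rule C1_ein_causal_curve_shift)

text \<open>Causal precedence without the reflexive clause of \<open>causal_future\<close>: the
  witnessing curve has \<open>a < b\<close>. This is why strict inequalities between times accompany
  it below.\<close>

definition env_precedes ::
    "('v::topological_space \<Rightarrow> (real ^ 'n::finite) \<times> real) \<Rightarrow>
     ((real ^ 'n) \<times> real) \<times> 'v set \<Rightarrow> ((real ^ 'n) \<times> real) \<times> 'v set \<Rightarrow> bool" where
  "env_precedes D p q \<longleftrightarrow> (\<exists>\<gamma> a b. env_causal_curve D \<gamma> a b \<and> \<gamma> a = p \<and> \<gamma> b = q)"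

lemma env_causal_curve_less: "env_causal_curve D \<gamma> a b \<Longrightarrow> a < b"
  by (simp add: env_causal_curve_def ein_causal_curve_def piecewise_def)

text \<open>The second curve is shifted by \<open>k\<close> so as to start at \<open>b\<close>. By
  \<open>eq\<close> the two formulas agree there, which makes \<open>\<eta>\<close> continuous and
  lets its second half coincide with the shifted curve on the closed interval.\<close>

lemma env_causal_curve_concat:
  assumes \<gamma>: "env_causal_curve D \<gamma> a b" and \<delta>: "env_causal_curve D \<delta> c e" and eq: "\<gamma> b = \<delta> c"
  defines "k \<equiv> b - c"
  defines "\<eta> \<equiv> \<lambda>s. if s \<le> b then \<gamma> s else \<delta> (s - k)"
  shows "env_causal_curve D \<eta> a (e + k)"
proof -
  have less: "a < b" "c < e" using \<gamma> \<delta> by (auto dest: env_causal_curve_less)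
  have "ein_causal_curve (fst \<circ> \<eta>) a b"
  proof (rule ein_causal_curve_cong)
    show "ein_causal_curve (fst \<circ> \<gamma>) a b" using \<gamma> by (simp add: env_causal_curve_def)
  qed (auto simp: \<eta>_def)
  moreover have "ein_causal_curve (fst \<circ> \<eta>) (c + k) (e + k)"
  proof (rule ein_causal_curve_cong)
    show "ein_causal_curve (\<lambda>s. (fst \<circ> \<delta>) (s - k)) (c + k) (e + k)"
      using \<delta> unfolding env_causal_curve_def by (blast intro: ein_causal_curve_shift)
  qed (auto simp: \<eta>_def k_def eq)
  ultimately have "ein_causal_curve (fst \<circ> \<eta>) a (e + k)"
    unfolding ein_causal_curve_def by (auto simp: k_def intro: piecewise_concat)
  moreover have "continuous_map (top_of_set {a..e + k}) (env_space D) \<eta>"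
    unfolding \<eta>_def
  proof (rule continuous_map_cases_le)
    have "{a..e + k} \<inter> {s \<in> {a..e + k}. s \<le> b} = {a..b}"
      using less by (auto simp: k_def)
    then show "continuous_map (subtopology (top_of_set {a..e + k})
        {x \<in> topspace (top_of_set {a..e + k}). x \<le> b}) (env_space D) \<gamma>"
      using \<gamma> by (simp add: subtopology_subtopology env_causal_curve_def)
    have "{a..e + k} \<inter> {s \<in> {a..e + k}. b \<le> s} = {b..e + k}"
      using less by (auto simp: k_def)
    moreover have "continuous_map (top_of_set {b..e + k}) (env_space D) (\<delta> \<circ> (\<lambda>s. s - k))"
    proof (rule continuous_map_compose)
      show "continuous_map (top_of_set {b..e + k}) (top_of_set {c..e}) (\<lambda>s. s - k)"
        by (auto simp: k_def intro!: continuous_intros)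
    qed (use \<delta> in \<open>simp add: env_causal_curve_def\<close>)
    ultimately show "continuous_map (subtopology (top_of_set {a..e + k})
        {x \<in> topspace (top_of_set {a..e + k}). b \<le> x}) (env_space D) (\<lambda>s. \<delta> (s - k))"
      by (simp add: subtopology_subtopology o_def)
  qed (auto simp: eq k_def)
  ultimately show ?thesis by (simp add: env_causal_curve_def)
qed

lemma env_precedes_trans:
  assumes "env_precedes D p q" "env_precedes D q r"
  shows "env_precedes D p r"
proof -
  obtain \<gamma> a b where \<gamma>: "env_causal_curve D \<gamma> a b" "\<gamma> a = p" "\<gamma> b = q"
    using assms(1) unfolding env_precedes_def by blast
  obtain \<delta> c e where \<delta>: "env_causal_curve D \<delta> c e" "\<delta> c = q" "\<delta> e = r"
    using assms(2) unfolding env_precedes_def by blast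
  have "a < b" "c < e" using \<gamma> \<delta> env_causal_curve_less by blast+
  then show ?thesis
    using env_causal_curve_concat[OF \<gamma>(1) \<delta>(1)] \<gamma>(2,3) \<delta>(2,3) unfolding env_precedes_def
    by (intro exI[of _ "\<lambda>s. if s \<le> b then \<gamma> s else \<delta> (s - (b - c))"] exI[of _ a]
        exI[of _ "e + (b - c)"]) simp
qed

text \<open>Convexity speaks of single curves from \<open>p\<close> to \<open>q\<close>;
  concatenation produces one that passes through \<open>r\<close>.\<close>

lemma causally_convexD:
  assumes "causally_convex (env_causal_curve D) \<Omega>"
    and "p \<in> \<Omega>" "q \<in> \<Omega>" "env_precedes D p r" "env_precedes D r q"
  shows "r \<in> \<Omega>"
proof -
  obtain \<gamma> a b where \<gamma>: "env_causal_curve D \<gamma> a b" "\<gamma> a = p" "\<gamma> b = r"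
    using assms(4) unfolding env_precedes_def by blast
  obtain \<delta> c e where \<delta>: "env_causal_curve D \<delta> c e" "\<delta> c = r" "\<delta> e = q"
    using assms(5) unfolding env_precedes_def by blast
  have less: "a < b" "c < e" using \<gamma> \<delta> env_causal_curve_less by blast+
  define \<eta> where "\<eta> = (\<lambda>s. if s \<le> b then \<gamma> s else \<delta> (s - (b - c)))"
  have "env_causal_curve D \<eta> a (e + (b - c))"
    unfolding \<eta>_def using \<gamma> \<delta> by (intro env_causal_curve_concat) auto
  moreover have "\<eta> a = p" "\<eta> b = r" "\<eta> (e + (b - c)) = q"
    using less \<gamma> \<delta> by (auto simp: \<eta>_def)
  ultimately have "\<eta> ` {a..e + (b - c)} \<subseteq> \<Omega>"
    using assms(1-3) unfolding causally_convex_def by metis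
  moreover have "b \<in> {a..e + (b - c)}" using less by auto
  ultimately show ?thesis using \<open>\<eta> b = r\<close> by blast
qed

text \<open>Passes from precedence in the whole enveloping space to curves inside
  \<open>\<Omega>\<close>, whose diamonds are the ones that global hyperbolicity makes
  compact.\<close>

lemma causally_convex_curves_in:
  assumes "causally_convex (env_causal_curve D) \<Omega>"
    and "p \<in> \<Omega>" "q \<in> \<Omega>" "env_precedes D p q"
  shows "\<exists>\<gamma> a b. curves_in \<Omega> (env_causal_curve D) \<gamma> a b \<and> \<gamma> a = p \<and> \<gamma> b = q"
proof -
  obtain \<gamma> a b where \<gamma>: "env_causal_curve D \<gamma> a b" "\<gamma> a = p" "\<gamma> b = q"
    using assms(4) unfolding env_precedes_def by blast
  then have "\<gamma> ` {a..b} \<subseteq> \<Omega>"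
    using assms(1-3) unfolding causally_convex_def by blast
  with \<gamma> show ?thesis unfolding curves_in_def by blast
qed

section \<open>Continuous extensions\<close>

lemma dist_closure_le:
  fixes A B :: "'a::metric_space set"
  assumes "\<And>x y. x \<in> A \<Longrightarrow> y \<in> B \<Longrightarrow> dist x y \<le> e" "x \<in> closure A" "y \<in> closure B"
  shows "dist x y \<le> e"
proof -
  have "continuous_on (closure (A \<times> B)) (\<lambda>p. dist (fst p) (snd p))"
    by (intro continuous_intros)
  then show ?thesis
    using continuous_le_on_closure[of "A \<times> B" "\<lambda>p. dist (fst p) (snd p)" "(x, y)" e] assms
    by (auto simp: closure_Times)
qed

text \<open>At points of \<open>U\<close> the oscillation hypothesis yields continuity; at the other
  points of the closure it makes the values of \<open>f\<close> Cauchy. Completeness of the reals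
  turns this into limits, and regularity of the real line turns pointwise limits into a continuous
  extension.\<close>

lemma continuous_extension_closure:
  fixes f :: "'x \<Rightarrow> real"
  assumes "U \<subseteq> topspace T"
    and cauchy: "\<And>x \<epsilon>. x \<in> T closure_of U \<Longrightarrow> 0 < \<epsilon> \<Longrightarrow>
      \<exists>N. openin T N \<and> x \<in> N \<and> (\<forall>y\<in>N \<inter> U. \<forall>z\<in>N \<inter> U. \<bar>f y - f z\<bar> \<le> \<epsilon>)"
  obtains h where "continuous_extension T U f h"
proof -
  have sub: "U \<subseteq> T closure_of U" using assms(1) by (rule closure_of_subset)
  have "openin (subtopology T U) {x \<in> U. f x \<in> V}" if V: "open V" for V
  proof (subst openin_subopen, rule ballI)
    fix x assume "x \<in> {x \<in> U. f x \<in> V}"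
    then have x: "x \<in> U" "f x \<in> V" by auto
    obtain e where e: "0 < e" "ball (f x) e \<subseteq> V" using V x(2) by (meson open_contains_ball)
    obtain N where N: "openin T N" "x \<in> N" "\<forall>y\<in>N \<inter> U. \<forall>z\<in>N \<inter> U. \<bar>f y - f z\<bar> \<le> e / 2"
      using cauchy[of x "e / 2"] sub x(1) e(1) by auto
    have "f y \<in> V" if "y \<in> N \<inter> U" for y
    proof -
      have "\<bar>f x - f y\<bar> \<le> e / 2" using N(2,3) x(1) that by blast
      then have "f y \<in> ball (f x) e" using e(1) by (simp add: dist_real_def)
      then show ?thesis using e(2) by blast
    qed
    then show "\<exists>S. openin (subtopology T U) S \<and> x \<in> S \<and> S \<subseteq> {x \<in> U. f x \<in> V}"
      using N(1,2) x(1) by (intro exI[of _ "U \<inter> N"]) (auto intro: openin_subtopology_Int2)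
  qed
  then have cont: "continuous_map (subtopology T U) euclideanreal f"
    using assms(1) by (simp add: continuous_map_def Int_absorb1)
  have lim: "\<exists>l. limitin euclideanreal f l (atin_within T x U)" if x: "x \<in> T closure_of U - U" for x
  proof -
    let ?F = "atin_within T x U"
    have "cauchy_filter (filtermap f ?F)"
      unfolding cauchy_filter_metric_filtermap
    proof (intro allI impI)
      fix e :: real assume "0 < e"
      then obtain N where N: "openin T N" "x \<in> N" "\<forall>y\<in>N \<inter> U. \<forall>z\<in>N \<inter> U. \<bar>f y - f z\<bar> \<le> e / 2"
        using cauchy[of x "e / 2"] x by auto
      have "dist (f y) (f z) < e" if "y \<in> N \<inter> U" "z \<in> N \<inter> U" for y z
      proof -
        have "\<bar>f y - f z\<bar> \<le> e / 2" using N(3) that by blast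
        then show ?thesis using \<open>0 < e\<close> by (simp add: dist_real_def)
      qed
      moreover have "eventually (\<lambda>y. y \<in> N \<inter> U) ?F"
        unfolding eventually_atin_within using N(1,2) by blast
      ultimately show "\<exists>P. eventually P ?F \<and> (\<forall>y z. P y \<and> P z \<longrightarrow> dist (f y) (f z) < e)"
        by (intro exI[of _ "\<lambda>y. y \<in> N \<inter> U"]) blast
    qed
    moreover have "complete (UNIV :: real set)"
      by (meson Cauchy_convergent UNIV_I complete_def convergent_def)
    \<comment> \<open>Completeness concerns proper Cauchy filters; the improper filter lies below
      every neighbourhood filter.\<close>
    ultimately have "\<exists>l. filtermap f ?F \<le> nhds l"
      using complete_uniform[of "UNIV :: real set"] by (cases "filtermap f ?F = bot") auto
    then show ?thesis by (auto simp: filterlim_def)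
  qed
  show ?thesis
  proof (rule continuous_map_extension_pointwise_alt[OF _ sub subset_refl cont lim])
    show "regular_space euclideanreal" by (rule regular_space_euclidean)
  qed (use that in \<open>auto simp: continuous_extension_def\<close>)
qed

text \<open>If the values differed by \<open>e\<close>, then \<open>h - k\<close> would exceed
  \<open>e / 2\<close> in absolute value at all closure points near \<open>x\<close>. But every
  neighbourhood of \<open>x\<close> meets \<open>U\<close>, and near \<open>x\<close> the functions
  are within \<open>e / 2\<close> of each other on \<open>U\<close>.\<close>

lemma continuous_extension_eq:
  assumes f: "continuous_extension T U f h" and g: "continuous_extension T U g k"
    and x: "x \<in> T closure_of U"
    and close: "\<And>\<epsilon>. 0 < \<epsilon> \<Longrightarrow> \<exists>N. openin T N \<and> x \<in> N \<and> (\<forall>y\<in>N \<inter> U. \<bar>f y - g y\<bar> \<le> \<epsilon>)"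
  shows "h x = k x"
proof (rule ccontr)
  assume ne: "h x \<noteq> k x"
  define e where "e = \<bar>h x - k x\<bar>"
  have "0 < e" using ne by (simp add: e_def)
  let ?C = "T closure_of U"
  have "continuous_map (subtopology T ?C) euclideanreal (\<lambda>y. h y - k y)"
    using f g unfolding continuous_extension_def by (intro continuous_map_diff) auto
  then have "openin (subtopology T ?C) {y \<in> topspace (subtopology T ?C). h y - k y \<in> - {- (e/2)..e/2}}"
    by (rule openin_continuous_map_preimage) (simp add: open_Compl)
  then obtain O' where O': "openin T O'"
    "{y \<in> topspace (subtopology T ?C). h y - k y \<in> - {- (e/2)..e/2}} = O' \<inter> ?C"
    unfolding openin_subtopology by blast
  obtain N where N: "openin T N" "x \<in> N" "\<forall>y\<in>N \<inter> U. \<bar>f y - g y\<bar> \<le> e / 2"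
    using close[of "e / 2"] \<open>0 < e\<close> by auto
  have "x \<in> topspace (subtopology T ?C)" using x by (simp add: closure_of_subset_topspace[THEN subsetD])
  moreover have "h x - k x \<in> - {- (e/2)..e/2}" 
  proof
    assume "h x - k x \<in> {- (e/2)..e/2}"
    then have "\<bar>h x - k x\<bar> \<le> e / 2" unfolding atLeastAtMost_iff by linarith
    then show False using \<open>0 < e\<close> by (simp add: e_def)
  qed
  ultimately have "x \<in> O' \<inter> N" using O'(2) N(2) by blast
  then obtain y where y: "y \<in> U" "y \<in> O'" "y \<in> N"
    using x O'(1) N(1) unfolding in_closure_of by (metis IntE openin_Int)
  then have "y \<in> ?C" using O'(1) openin_subset by (fastforce simp: in_closure_of)
  then have "h y - k y \<in> - {- (e/2)..e/2}" using O'(2) y(2) by blast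
  moreover have "\<bar>h y - k y\<bar> \<le> e / 2"
    using N(3) y f g by (auto simp: continuous_extension_def)
  ultimately show False unfolding Compl_iff atLeastAtMost_iff by linarith
qed

section \<open>The leaf space\<close>

text \<open>Isolates the topological content of a developing map. The charts of the leaf space and
  the causal relations in the enveloping space are derived from this local homeomorphism.\<close>

locale ein_development =
  fixes D :: "'v::t2_space \<Rightarrow> (real ^ 'n::finite) \<times> real"
  assumes local_homeo: "\<And>p. \<exists>W. open W \<and> p \<in> W \<and>
    homeomorphism W (D ` W) D (inv_into W D) \<and> openin (top_of_set Ein) (D ` W)"
begin

lemma norm_fst_dev: "norm (fst (D p)) = 1"
proof -
  obtain W where "p \<in> W" "openin (top_of_set Ein) (D ` W)" using local_homeo[of p] by blast
  then have "D p \<in> Ein" using openin_imp_subset by blast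
  then show ?thesis by (auto simp: Ein_def mem_Times_iff)
qed

lemma continuous_dev: "continuous_on UNIV D"
proof -
  have "isCont D p" for p
  proof -
    obtain W where "open W" "p \<in> W" "homeomorphism W (D ` W) D (inv_into W D)"
      using local_homeo[of p] by blast
    then show ?thesis by (meson continuous_on_eq_continuous_at homeomorphism_cont1)
  qed
  then show ?thesis by (simp add: continuous_on_eq_continuous_at)
qed

lemma open_map_dev:
  assumes "open O'"
  shows "openin (top_of_set Ein) (D ` O')"
proof (subst openin_subopen, rule ballI)
  fix y assume "y \<in> D ` O'"
  then obtain p where "p \<in> O'" "y = D p" by blast
  obtain W where W: "open W" "p \<in> W" "homeomorphism W (D ` W) D (inv_into W D)"
    "openin (top_of_set Ein) (D ` W)" using local_homeo[of p] by blast
  have "openin (top_of_set W) (W \<inter> O')" using assms by (rule openin_open_Int)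
  then have "openin (top_of_set (D ` W)) (D ` (W \<inter> O'))"
    using homeomorphism_imp_open_map W(3) by blast
  then have "openin (top_of_set Ein) (D ` (W \<inter> O'))" using W(4) openin_trans by blast
  then show "\<exists>T. openin (top_of_set Ein) T \<and> y \<in> T \<and> T \<subseteq> D ` O'"
    using W(2) \<open>p \<in> O'\<close> \<open>y = D p\<close> by (intro exI[of _ "D ` (W \<inter> O')"]) auto
qed

lemma open_map_fst_dev:
  assumes "open O'"
  shows "openin (top_of_set (sphere 0 1)) ((\<lambda>p. fst (D p)) ` O')"
proof -
  have "openin (prod_topology (top_of_set (sphere 0 1)) (top_of_set UNIV)) (D ` O')"
    using open_map_dev[OF assms] by (simp only: prod_topology_subtopology_eu Ein_def)
  then have "openin (top_of_set (sphere 0 1)) (fst ` D ` O')"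
    using open_map_fst open_map_def by blast
  then show ?thesis by (simp add: image_image)
qed

section \<open>Leaves as vertical curves\<close>

lemma leaf_curve_dev:
  assumes "\<forall>s\<in>{a..b}. ((D \<circ> \<gamma>) has_vector_derivative (0, 1)) (at s within {a..b})"
    and "s \<in> {a..b}" "r \<in> {a..b}"
  shows "D (\<gamma> s) = D (\<gamma> r) + (0, s - r)"
proof -
  \<comment> \<open>Subtracting the vertical line leaves a function with zero derivative on an
    interval, hence a constant.\<close>
  have "((\<lambda>s. D (\<gamma> s) - (0, s)) has_vector_derivative 0) (at s within {a..b})" if "s \<in> {a..b}" for s
  proof -
    have "((\<lambda>s. (0::real^'n, s)) has_vector_derivative (0, 1)) (at s within {a..b})"
      by (intro has_vector_derivative_Pair derivative_intros)
    moreover have "((\<lambda>s. D (\<gamma> s)) has_vector_derivative (0, 1)) (at s within {a..b})"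
      using assms(1) that by (simp add: o_def)
    ultimately show ?thesis
      using has_vector_derivative_diff by fastforce
  qed
  then obtain c where "\<And>s. s \<in> {a..b} \<Longrightarrow> D (\<gamma> s) - (0, s) = c"
    using has_vector_derivative_zero_constant[of "{a..b}" "\<lambda>s. D (\<gamma> s) - (0, s)"] by auto
  then have "D (\<gamma> s) - (0, s) = D (\<gamma> r) - (0, r)" using assms by metis
  then show ?thesis by (simp add: prod_eq_iff algebra_simps)
qed

text \<open>A leaf segment parametrised by the time coordinate of \<open>D\<close>. Two segments
  over the same \<open>\<xi>\<close> then have equal images under \<open>D\<close> at equal
  parameters, which is the setting of \<open>dev_lift_unique\<close>.\<close>

definition vertical :: "(real \<Rightarrow> 'v) \<Rightarrow> real \<Rightarrow> real \<Rightarrow> real ^ 'n \<Rightarrow> bool" where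
  "vertical \<gamma> a b \<xi> \<longleftrightarrow> continuous_on {a..b} \<gamma> \<and> (\<forall>s\<in>{a..b}. D (\<gamma> s) = (\<xi>, s))"

lemma leaf_rel_iff_vertical:
  "(x, y) \<in> leaf_rel D \<longleftrightarrow>
     (\<exists>\<gamma> a b \<xi>. vertical \<gamma> a b \<xi> \<and> x \<in> \<gamma> ` {a..b} \<and> y \<in> \<gamma> ` {a..b})"
proof
  assume "(x, y) \<in> leaf_rel D"
  then obtain \<gamma> a b where \<gamma>: "continuous_on {a..b} \<gamma>" "x \<in> \<gamma> ` {a..b}" "y \<in> \<gamma> ` {a..b}"
    "\<forall>s\<in>{a..b}. ((D \<circ> \<gamma>) has_vector_derivative (0, 1)) (at s within {a..b})"
    unfolding leaf_rel_def by blast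
  then obtain r where r: "r \<in> {a..b}" by blast
  \<comment> \<open>Time minus parameter, which is constant along the curve; shifting by it makes
    the parameter equal to the time.\<close>
  define k where "k = snd (D (\<gamma> r)) - r"
  have im: "(\<lambda>s. s - k) ` {a + k..b + k} = {a..b}"
    by (simp add: image_diff_atLeastAtMost)
  have "vertical (\<lambda>s. \<gamma> (s - k)) (a + k) (b + k) (fst (D (\<gamma> r)))"
    unfolding vertical_def
  proof (intro conjI ballI)
    show "continuous_on {a + k..b + k} (\<lambda>s. \<gamma> (s - k))"
      by (rule continuous_on_compose2[OF \<gamma>(1)]) (auto intro!: continuous_intros)
    fix s assume "s \<in> {a + k..b + k}"
    then have "D (\<gamma> (s - k)) = D (\<gamma> r) + (0, s - k - r)"
      using r by (intro leaf_curve_dev[OF \<gamma>(4)]) auto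
    then show "D (\<gamma> (s - k)) = (fst (D (\<gamma> r)), s)"
      by (simp add: prod_eq_iff k_def)
  qed
  moreover have "(\<lambda>s. \<gamma> (s - k)) ` {a + k..b + k} = \<gamma> ` {a..b}"
    using im by (metis image_image)
  ultimately show "\<exists>\<gamma> a b \<xi>. vertical \<gamma> a b \<xi> \<and> x \<in> \<gamma> ` {a..b} \<and> y \<in> \<gamma> ` {a..b}"
    using \<gamma>(2,3) by metis
next
  assume "\<exists>\<gamma> a b \<xi>. vertical \<gamma> a b \<xi> \<and> x \<in> \<gamma> ` {a..b} \<and> y \<in> \<gamma> ` {a..b}"
  then obtain \<gamma> a b \<xi> where \<gamma>: "vertical \<gamma> a b \<xi>" "x \<in> \<gamma> ` {a..b}" "y \<in> \<gamma> ` {a..b}"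
    by blast
  have "((D \<circ> \<gamma>) has_vector_derivative (0, 1)) (at s within {a..b})" if "s \<in> {a..b}" for s
  proof (rule has_vector_derivative_transform[OF that])
    show "((\<lambda>s. (\<xi>, s)) has_vector_derivative (0, 1)) (at s within {a..b})"
      by (intro has_vector_derivative_Pair derivative_intros)
  qed (use \<gamma>(1) in \<open>simp add: vertical_def\<close>)
  then show "(x, y) \<in> leaf_rel D"
    unfolding leaf_rel_def using \<gamma> by (blast dest: vertical_def[THEN iffD1])
qed

lemma leaf_rel_refl: "(x, x) \<in> leaf_rel D"
proof -
  \<comment> \<open>The parameter interval is a single point, so the constant curve
    qualifies.\<close>
  have "vertical (\<lambda>_. x) (snd (D x)) (snd (D x)) (fst (D x))" by (simp add: vertical_def)
  then show ?thesis unfolding leaf_rel_iff_vertical by fastforce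
qed

lemma leaf_rel_sym: "(x, y) \<in> leaf_rel D \<Longrightarrow> (y, x) \<in> leaf_rel D"
  unfolding leaf_rel_def by blast

lemma leaf_rel_fst_dev: "(x, y) \<in> leaf_rel D \<Longrightarrow> fst (D x) = fst (D y)"
  unfolding leaf_rel_iff_vertical vertical_def by force

text \<open>Unique lifting through a local homeomorphism: agreement is an open condition by local
  injectivity of \<open>D\<close>, disagreement because the domain of \<open>D\<close> is
  Hausdorff.\<close>

lemma dev_lift_unique:
  assumes "connected S" "continuous_on S \<gamma>" "continuous_on S \<delta>"
    and eq: "\<And>s. s \<in> S \<Longrightarrow> D (\<gamma> s) = D (\<delta> s)" and "r \<in> S" "\<gamma> r = \<delta> r" "s \<in> S"
  shows "\<gamma> s = \<delta> s"
proof (rule connected_induction_simple[OF \<open>connected S\<close> \<open>r \<in> S\<close> \<open>s \<in> S\<close>, where P = "\<lambda>s. \<gamma> s = \<delta> s"])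
  fix u assume u: "u \<in> S"
  show "\<exists>T. openin (top_of_set S) T \<and> u \<in> T \<and> (\<forall>x\<in>T. \<forall>y\<in>T. \<gamma> x = \<delta> x \<longrightarrow> \<gamma> y = \<delta> y)"
  proof (cases "\<gamma> u = \<delta> u")
    case True
    obtain W where W: "open W" "\<gamma> u \<in> W" "homeomorphism W (D ` W) D (inv_into W D)"
      using local_homeo[of "\<gamma> u"] by blast
    then have inj: "inj_on D W" by (intro inj_on_inverseI) (rule homeomorphism_apply1)
    have "openin (top_of_set S) (S \<inter> \<gamma> -` W)" "openin (top_of_set S) (S \<inter> \<delta> -` W)"
      using assms(2,3) W(1) by (auto intro: continuous_openin_preimage_gen)
    then show ?thesis
      using u W(2) True inj_onD[OF inj] eq
      by (intro exI[of _ "(S \<inter> \<gamma> -` W) \<inter> (S \<inter> \<delta> -` W)"]) auto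
  next
    case False
    then obtain A B where AB: "open A" "open B" "\<gamma> u \<in> A" "\<delta> u \<in> B" "A \<inter> B = {}"
      using hausdorff[OF False] by blast
    define T where "T = (S \<inter> \<gamma> -` A) \<inter> (S \<inter> \<delta> -` B)"
    have "openin (top_of_set S) T"
      unfolding T_def using assms(2,3) AB(1,2) by (intro openin_Int continuous_openin_preimage_gen)
    moreover have "u \<in> T" using u AB(3,4) by (simp add: T_def)
    moreover have "\<gamma> x \<noteq> \<delta> x" if "x \<in> T" for x
      using that AB(5) by (auto simp: T_def)
    ultimately show ?thesis by blast
  qed
qed (rule assms)

text \<open>Both vertical curves pass through \<open>y\<close> at time \<open>snd (D y)\<close>.
  Hence they lie over the same \<open>\<xi>\<close>, agree on the common interval by unique lifting,
  and glue to one vertical curve.\<close>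

lemma leaf_rel_trans:
  assumes "(x, y) \<in> leaf_rel D" "(y, z) \<in> leaf_rel D"
  shows "(x, z) \<in> leaf_rel D"
proof -
  obtain \<gamma> a b \<xi> where \<gamma>: "continuous_on {a..b} \<gamma>" "\<forall>s\<in>{a..b}. D (\<gamma> s) = (\<xi>, s)"
    "x \<in> \<gamma> ` {a..b}" "y \<in> \<gamma> ` {a..b}"
    using assms(1) unfolding leaf_rel_iff_vertical vertical_def by blast
  obtain \<delta> c e \<zeta> where \<delta>: "continuous_on {c..e} \<delta>" "\<forall>s\<in>{c..e}. D (\<delta> s) = (\<zeta>, s)"
    "y \<in> \<delta> ` {c..e}" "z \<in> \<delta> ` {c..e}"
    using assms(2) unfolding leaf_rel_iff_vertical vertical_def by blast
  define r where "r = snd (D y)"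
  have r: "r \<in> {a..b}" "\<gamma> r = y" "r \<in> {c..e}" "\<delta> r = y"
    using \<gamma> \<delta> by (auto simp: r_def)
  then have "\<xi> = \<zeta>" using \<gamma>(2) \<delta>(2) by (metis fst_conv)
  have agree: "\<gamma> s = \<delta> s" if "s \<in> {a..b} \<inter> {c..e}" for s
  proof (rule dev_lift_unique[where S = "{a..b} \<inter> {c..e}"])
    show "connected ({a..b} \<inter> {c..e})" by simp
    show "continuous_on ({a..b} \<inter> {c..e}) \<gamma>" "continuous_on ({a..b} \<inter> {c..e}) \<delta>"
      using \<gamma>(1) \<delta>(1) by (auto intro: continuous_on_subset)
    show "D (\<gamma> s) = D (\<delta> s)" if "s \<in> {a..b} \<inter> {c..e}" for s
      using that \<gamma>(2) \<delta>(2) \<open>\<xi> = \<zeta>\<close> by simp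
    show "\<gamma> r = \<delta> r" "r \<in> {a..b} \<inter> {c..e}" using r by auto
  qed (rule that)
  define \<eta> where "\<eta> s = (if s \<in> {a..b} then \<gamma> s else \<delta> s)" for s
  have un: "{a..b} \<union> {c..e} = {min a c..max b e}" using r by auto
  have "continuous_on ({a..b} \<union> {c..e}) \<eta>"
    unfolding \<eta>_def using agree \<gamma>(1) \<delta>(1) by (intro continuous_on_cases) auto
  then have "vertical \<eta> (min a c) (max b e) \<xi>"
    unfolding vertical_def un[symmetric] using \<gamma>(2) \<delta>(2) \<open>\<xi> = \<zeta>\<close> by (auto simp: \<eta>_def)
  moreover have "x \<in> \<eta> ` ({a..b} \<union> {c..e})" using \<gamma>(3) by (force simp: \<eta>_def)
  moreover have "z \<in> \<eta> ` ({a..b} \<union> {c..e})"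
  proof -
    obtain s where "s \<in> {c..e}" "z = \<delta> s" using \<delta>(4) by blast
    then have "\<eta> s = z" using agree by (auto simp: \<eta>_def)
    then show ?thesis using \<open>s \<in> {c..e}\<close> by blast
  qed
  ultimately show ?thesis unfolding leaf_rel_iff_vertical un by blast
qed

lemma mem_leaf_proj: "x \<in> leaf_proj D x"
  by (simp add: leaf_proj_def leaf_rel_refl)

lemma leaf_proj_eq_iff: "leaf_proj D x = leaf_proj D y \<longleftrightarrow> (x, y) \<in> leaf_rel D"
proof
  assume "leaf_proj D x = leaf_proj D y"
  then show "(x, y) \<in> leaf_rel D" using mem_leaf_proj[of y] by (auto simp: leaf_proj_def)
next
  assume "(x, y) \<in> leaf_rel D"
  then show "leaf_proj D x = leaf_proj D y"
    unfolding leaf_proj_def using leaf_rel_trans leaf_rel_sym by blast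
qed

text \<open>Since \<open>fst \<circ> D\<close> is constant on a leaf, the \<open>the_elem\<close> in
  \<open>leaf_dev\<close> is applied to a singleton.\<close>

lemma leaf_dev_leaf_proj: "leaf_dev D (leaf_proj D x) = fst (D x)"
proof -
  have "fst (D y) \<in> {fst (D x)}" if "y \<in> leaf_proj D x" for y
    using leaf_rel_fst_dev[of x y] that by (simp add: leaf_proj_def)
  then have "(\<lambda>y. fst (D y)) ` leaf_proj D x \<subseteq> {fst (D x)}" by (rule image_subsetI)
  then have "(\<lambda>y. fst (D y)) ` leaf_proj D x = {fst (D x)}"
    using mem_leaf_proj[of x] by (metis empty_iff image_is_empty subset_singletonD)
  then show ?thesis by (simp add: leaf_dev_def o_def)
qed

lemma norm_leaf_dev: "b \<in> topspace (leaf_space D) \<Longrightarrow> norm (leaf_dev D b) = 1"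
  by (auto simp: topspace_leaf_space leaf_dev_leaf_proj norm_fst_dev)

text \<open>A flow box. The set \<open>N\<close> corresponds under \<open>D\<close> to a product
  whose time factor is an interval, so the vertical segment between two image points over the same
  \<open>\<xi>\<close> stays in the image of \<open>W\<close> and lifts through the local inverse of
  \<open>D\<close>.\<close>

lemma leaf_box:
  obtains N where "open N" "p \<in> N"
    "\<And>x y. x \<in> N \<Longrightarrow> y \<in> N \<Longrightarrow> fst (D x) = fst (D y) \<Longrightarrow> (x, y) \<in> leaf_rel D"
proof -
  obtain W where W: "open W" "p \<in> W" "homeomorphism W (D ` W) D (inv_into W D)"
    "openin (top_of_set Ein) (D ` W)" using local_homeo[of p] by blast
  then have inj: "inj_on D W" by (intro inj_on_inverseI) (rule homeomorphism_apply1)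
  obtain T where T: "open T" "D ` W = Ein \<inter> T" using W(4) by (auto simp: openin_open)
  then have "D p \<in> T" using W(2) by blast
  then obtain A B where AB: "open A" "open B" "fst (D p) \<in> A" "snd (D p) \<in> B" "A \<times> B \<subseteq> T"
    using \<open>open T\<close> by (metis mem_Times_iff open_prod_elim)
  obtain e where e: "0 < e" "ball (snd (D p)) e \<subseteq> B" using AB by (meson open_contains_ball)
  define N where "N = W \<inter> D -` (A \<times> ball (snd (D p)) e)"
  have "open N"
  proof -
    have "continuous_on W D" using continuous_dev continuous_on_subset by blast
    then show ?thesis
      unfolding N_def using W(1) AB(1)
      by (intro continuous_on_open_vimage[THEN iffD1, rule_format] continuous_open_preimage open_Times) auto
  qed
  moreover have "p \<in> N" using W AB e by (auto simp: N_def mem_Times_iff)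
  moreover have "(x, y) \<in> leaf_rel D"
    if "x \<in> N" "y \<in> N" "fst (D x) = fst (D y)" "snd (D x) \<le> snd (D y)" for x y
  proof -
    define \<xi> where "\<xi> = fst (D x)"
    define I where "I = {snd (D x)..snd (D y)}"
    have "I \<subseteq> ball (snd (D p)) e"
      using that by (auto simp: I_def N_def mem_Times_iff dist_real_def)
    moreover have "\<xi> \<in> A" "norm \<xi> = 1" using that norm_fst_dev by (auto simp: \<xi>_def N_def mem_Times_iff)
    ultimately have sub: "{\<xi>} \<times> I \<subseteq> D ` W"
      unfolding T(2) using AB(5) e(2) by (auto simp: Ein_def)
    have "vertical (\<lambda>s. inv_into W D (\<xi>, s)) (snd (D x)) (snd (D y)) \<xi>"
      unfolding vertical_def
    proof (intro conjI ballI)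
      have "continuous_on (D ` W) (inv_into W D)" using W(3) by (rule homeomorphism_cont2)
      then show "continuous_on {snd (D x)..snd (D y)} (\<lambda>s. inv_into W D (\<xi>, s))"
      proof (rule continuous_on_compose2)
        show "(\<lambda>s. (\<xi>, s)) ` {snd (D x)..snd (D y)} \<subseteq> D ` W"
          using sub unfolding I_def by blast
      qed (intro continuous_intros)
      show "D (inv_into W D (\<xi>, s)) = (\<xi>, s)" if "s \<in> {snd (D x)..snd (D y)}" for s
        using sub that unfolding I_def by (intro f_inv_into_f) blast
    qed
    moreover have "(\<xi>, snd (D x)) = D x" "(\<xi>, snd (D y)) = D y"
      using that(3) by (simp_all add: \<xi>_def prod_eq_iff)
    then have "inv_into W D (\<xi>, snd (D x)) = x" "inv_into W D (\<xi>, snd (D y)) = y"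
      using that(1,2) inv_into_f_f[OF inj] by (simp_all add: N_def)
    ultimately show ?thesis
      unfolding leaf_rel_iff_vertical using that(4)
      by (metis atLeastAtMost_iff image_eqI order_refl)
  qed
  then have "(x, y) \<in> leaf_rel D" if "x \<in> N" "y \<in> N" "fst (D x) = fst (D y)" for x y
    using that leaf_rel_sym by (metis linear)
  ultimately show ?thesis using that by blast
qed

text \<open>Follows a leaf from a point of \<open>W\<close>: inside a flow box, membership in the
  interior of the saturation passes from each point of the curve to every other, so by connectedness
  it spreads along the whole curve.\<close>

lemma open_leaf_saturation:
  assumes "open W"
  shows "open (leaf_rel D `` W)"
proof -
  let ?S = "interior (leaf_rel D `` W)"
  have "x \<in> ?S" if xy: "(y, x) \<in> leaf_rel D" "y \<in> W" for x y
  proof -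
    obtain \<gamma> a b \<xi> where \<gamma>: "continuous_on {a..b} \<gamma>" "\<forall>s\<in>{a..b}. D (\<gamma> s) = (\<xi>, s)"
      "y \<in> \<gamma> ` {a..b}" "x \<in> \<gamma> ` {a..b}"
      using xy(1) unfolding leaf_rel_iff_vertical vertical_def by blast
    obtain s r where sr: "s \<in> {a..b}" "y = \<gamma> s" "r \<in> {a..b}" "x = \<gamma> r" using \<gamma> by blast
    have "W \<subseteq> leaf_rel D `` W" using leaf_rel_refl by blast
    then have yS: "y \<in> ?S" using assms xy(2) interior_maximal by blast
    have "\<gamma> r \<in> ?S"
    proof (rule connected_induction_simple[of "{a..b}" s r "\<lambda>s. \<gamma> s \<in> ?S"])
      fix u assume u: "u \<in> {a..b}"
      obtain N where N: "open N" "\<gamma> u \<in> N"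
        "\<And>x y. x \<in> N \<Longrightarrow> y \<in> N \<Longrightarrow> fst (D x) = fst (D y) \<Longrightarrow> (x, y) \<in> leaf_rel D"
        using leaf_box[of "\<gamma> u"] by blast
      have "\<gamma> v \<in> ?S" if v: "w \<in> {a..b}" "v \<in> {a..b}" "\<gamma> w \<in> N" "\<gamma> v \<in> N" "\<gamma> w \<in> ?S" for v w
      proof -
        \<comment> \<open>The shadow on the sphere. Each point of \<open>N\<close> over
          \<open>M\<close> shares its leaf with a point of the interior; as \<open>M\<close> is
          open, these points form an open subset of the saturation, and \<open>\<gamma> v\<close> is
          one of them.\<close>
        define M where "M = (\<lambda>p. fst (D p)) ` (N \<inter> ?S)"
        have "openin (top_of_set (sphere 0 1)) M"
          unfolding M_def using N(1) by (intro open_map_fst_dev open_Int) auto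
        then obtain T where T: "open T" "M = sphere 0 1 \<inter> T" by (auto simp: openin_open)
        have "open (N \<inter> D -` (T \<times> UNIV))"
          using N(1) T(1) continuous_dev
          by (intro open_Int open_vimage open_Times) auto
        moreover have "N \<inter> D -` (T \<times> UNIV) \<subseteq> leaf_rel D `` W"
        proof
          fix q assume q: "q \<in> N \<inter> D -` (T \<times> UNIV)"
          then have "fst (D q) \<in> M" using T(2) norm_fst_dev by (auto simp: mem_Times_iff)
          then obtain q' where q': "q' \<in> N" "q' \<in> ?S" "fst (D q) = fst (D q')" by (auto simp: M_def)
          then have "(q', q) \<in> leaf_rel D" using N(3) q by auto
          moreover have "q' \<in> leaf_rel D `` W" using q'(2) interior_subset by blast
          ultimately show "q \<in> leaf_rel D `` W" using leaf_rel_trans by blast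
        qed
        moreover have "fst (D (\<gamma> v)) \<in> M"
          using v \<gamma>(2) unfolding M_def by (intro image_eqI[of _ _ "\<gamma> w"]) auto
        then have "\<gamma> v \<in> N \<inter> D -` (T \<times> UNIV)" using v(4) T(2) by (auto simp: mem_Times_iff)
        ultimately show ?thesis using interior_maximal by blast
      qed
      then have "\<forall>x\<in>{a..b} \<inter> \<gamma> -` N. \<forall>y\<in>{a..b} \<inter> \<gamma> -` N. \<gamma> x \<in> ?S \<longrightarrow> \<gamma> y \<in> ?S" by blast
      moreover have "openin (top_of_set {a..b}) ({a..b} \<inter> \<gamma> -` N)"
        using \<gamma>(1) N(1) by (rule continuous_openin_preimage_gen)
      ultimately show "\<exists>T. openin (top_of_set {a..b}) T \<and> u \<in> T \<and>
          (\<forall>x\<in>T. \<forall>y\<in>T. \<gamma> x \<in> ?S \<longrightarrow> \<gamma> y \<in> ?S)"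
        using u N(2) by (intro exI[of _ "{a..b} \<inter> \<gamma> -` N"] conjI) simp_all
    qed (use sr yS in simp_all)
    then show ?thesis using sr by simp
  qed
  then have "leaf_rel D `` W \<subseteq> ?S" by blast
  then show ?thesis by (metis interior_subset open_interior subset_antisym)
qed

section \<open>Open maps and charts of the leaf space\<close>

lemma open_map_leaf_proj:
  assumes "open W"
  shows "openin (leaf_space D) (leaf_proj D ` W)"
proof -
  have "leaf_proj D -` leaf_proj D ` W = leaf_rel D `` W"
    using leaf_proj_eq_iff leaf_rel_sym by blast
  then show ?thesis
    using open_leaf_saturation[OF assms] by (auto simp: openin_leaf_space)
qed

lemma continuous_map_leaf_dev:
  "continuous_map (leaf_space D) (top_of_set (sphere 0 1)) (leaf_dev D)"
proof (rule continuous_compose_quotient_map[OF quotient_map_leaf_proj])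
  have "continuous_on UNIV (\<lambda>p. fst (D p))" using continuous_dev by (rule continuous_on_fst)
  then show "continuous_map euclidean (top_of_set (sphere 0 1)) (leaf_dev D \<circ> leaf_proj D)"
    by (auto simp: continuous_map_in_subtopology o_def leaf_dev_leaf_proj norm_fst_dev)
qed

lemma open_map_leaf_dev:
  assumes "openin (leaf_space D) U"
  shows "openin (top_of_set (sphere 0 1)) (leaf_dev D ` U)"
proof -
  have U: "U \<subseteq> range (leaf_proj D)" "open (leaf_proj D -` U)"
    using assms by (auto simp: openin_leaf_space)
  have "U = leaf_proj D ` (leaf_proj D -` U)" using U(1) by blast
  then have "leaf_dev D ` U = (\<lambda>p. fst (D p)) ` (leaf_proj D -` U)"
    by (metis (no_types, lifting) image_cong image_image leaf_dev_leaf_proj)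
  then show ?thesis using open_map_fst_dev U(2) by simp
qed

text \<open>The radius is at most 1 so that any two points of the chart are joined by a great arc
  inside it.\<close>

definition leaf_chart :: "'v set set \<Rightarrow> real ^ 'n \<Rightarrow> real \<Rightarrow> bool" where
  "leaf_chart W \<xi> r \<longleftrightarrow> 0 < r \<and> r \<le> 1 \<and> norm \<xi> = 1 \<and> openin (leaf_space D) W \<and>
     inj_on (leaf_dev D) W \<and> leaf_dev D ` W = sphere 0 1 \<inter> ball \<xi> r"

lemma ex_leaf_chart:
  assumes "b \<in> topspace (leaf_space D)"
  obtains W r where "leaf_chart W (leaf_dev D b) r" "b \<in> W"
proof -
  obtain p where p: "b = leaf_proj D p" using assms by (auto simp: topspace_leaf_space)
  obtain N where N: "open N" "p \<in> N"
    "\<And>x y. x \<in> N \<Longrightarrow> y \<in> N \<Longrightarrow> fst (D x) = fst (D y) \<Longrightarrow> (x, y) \<in> leaf_rel D"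
    using leaf_box by blast
  define V where "V = leaf_proj D ` N"
  have V: "openin (leaf_space D) V" "b \<in> V" unfolding V_def p using N open_map_leaf_proj by auto
  \<comment> \<open>In a flow box, equal sphere components mean equal leaves.\<close>
  have inj: "inj_on (leaf_dev D) V"
    unfolding V_def inj_on_def ball_simps(9) leaf_dev_leaf_proj using N(3) leaf_proj_eq_iff by blast
  obtain T where T: "open T" "leaf_dev D ` V = sphere 0 1 \<inter> T"
    using open_map_leaf_dev[OF V(1)] by (auto simp: openin_open)
  then have "leaf_dev D b \<in> T" using V(2) by blast
  then obtain e where e: "0 < e" "ball (leaf_dev D b) e \<subseteq> T" using T(1) by (meson open_contains_ball)
  define r where "r = min e 1"
  define W where "W = {x \<in> topspace (leaf_space D). leaf_dev D x \<in> sphere 0 1 \<inter> ball (leaf_dev D b) r} \<inter> V"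
  have "openin (leaf_space D) W"
    unfolding W_def using V(1)
    by (intro openin_Int openin_continuous_map_preimage[OF continuous_map_leaf_dev] openin_open_Int) auto
  moreover have "leaf_dev D ` W = sphere 0 1 \<inter> ball (leaf_dev D b) r"
  proof
    show "sphere 0 1 \<inter> ball (leaf_dev D b) r \<subseteq> leaf_dev D ` W"
    proof
      fix \<xi> assume \<xi>: "\<xi> \<in> sphere 0 1 \<inter> ball (leaf_dev D b) r"
      then have "\<xi> \<in> sphere 0 1 \<inter> T" using e(2) by (auto simp: r_def)
      then obtain x where x: "x \<in> V" "\<xi> = leaf_dev D x" using T(2) by blast
      then have "x \<in> W" using \<xi> openin_subset[OF V(1)] by (auto simp: W_def)
      then show "\<xi> \<in> leaf_dev D ` W" using x(2) by blast
    qed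
  qed (auto simp: W_def)
  moreover have "inj_on (leaf_dev D) W" using inj by (rule inj_on_subset) (auto simp: W_def)
  moreover have "b \<in> W" "0 < r" "r \<le> 1" "norm (leaf_dev D b) = 1"
    using V(2) assms e(1) norm_leaf_dev by (auto simp: W_def r_def)
  ultimately show ?thesis using that[of W r] by (simp add: leaf_chart_def)
qed

text \<open>The preimage of an open \<open>U\<close> under the inverse is the image of
  \<open>W \<inter> U\<close> under the open map \<open>leaf_dev D\<close>.\<close>

lemma leaf_chart_inverse:
  assumes "leaf_chart W \<xi> r"
  shows "continuous_map (top_of_set (sphere 0 1 \<inter> ball \<xi> r)) (leaf_space D) (inv_into W (leaf_dev D))"
proof -
  let ?S = "sphere 0 1 \<inter> ball \<xi> r" and ?h = "inv_into W (leaf_dev D)"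
  have W: "openin (leaf_space D) W" "inj_on (leaf_dev D) W" "leaf_dev D ` W = ?S"
    using assms by (auto simp: leaf_chart_def)
  have "openin (top_of_set ?S) {x \<in> ?S. ?h x \<in> U}" if U: "openin (leaf_space D) U" for U
  proof -
    have "{x \<in> ?S. ?h x \<in> U} = leaf_dev D ` (W \<inter> U)"
      using W(2) unfolding W(3)[symmetric] by auto
    moreover have "openin (top_of_set (sphere 0 1)) (leaf_dev D ` (W \<inter> U))"
      using W(1) U by (intro open_map_leaf_dev openin_Int)
    ultimately have "openin (top_of_set (sphere 0 1)) {x \<in> ?S. ?h x \<in> U}" by simp
    then show ?thesis by (rule openin_subset_trans) blast+
  qed
  moreover have "?h \<in> ?S \<rightarrow> topspace (leaf_space D)"
    using inv_into_into[of _ "leaf_dev D" W] openin_subset[OF W(1)] unfolding W(3) by blast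
  ultimately show ?thesis unfolding continuous_map_def topspace_euclidean_subtopology by blast
qed

section \<open>The global trivialization\<close>

lemma continuous_map_env_triv:
  "continuous_map (prod_topology (leaf_space D) euclideanreal) (env_space D) (env_triv D)"
proof -
  have "continuous_map (prod_topology (leaf_space D) euclideanreal) (top_of_set (sphere 0 1))
      (\<lambda>x. leaf_dev D (fst x))"
    using continuous_map_compose[OF continuous_map_fst continuous_map_leaf_dev] by (simp add: o_def)
  moreover have "continuous_map (prod_topology (leaf_space D) euclideanreal) (top_of_set UNIV) snd"
    using continuous_map_snd by (simp only: subtopology_UNIV)
  ultimately have "continuous_map (prod_topology (leaf_space D) euclideanreal)
      (prod_topology (prod_topology (top_of_set (sphere 0 1)) (top_of_set UNIV)) (leaf_space D))
      (\<lambda>x. ((leaf_dev D (fst x), snd x), fst x))"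
    by (intro continuous_map_pairedI continuous_map_fst)
  then have "continuous_map (prod_topology (leaf_space D) euclideanreal)
      (prod_topology (top_of_set Ein) (leaf_space D)) (env_triv D)"
    unfolding env_triv_def prod_topology_subtopology_eu Ein_def case_prod_unfold .
  then show ?thesis
    unfolding env_space_def continuous_map_in_subtopology by (auto simp: env_triv_def)
qed

lemma env_spaceD:
  assumes "p \<in> topspace (env_space D)"
  shows "snd p \<in> topspace (leaf_space D)" "p = env_triv D (snd p, snd (fst p))"
  using assms by (auto simp: env_space_def env_triv_def prod_eq_iff)

end

section \<open>Causality of the enveloping space\<close>

context ein_development
begin

lemma leaf_chart_subset_topspace: "leaf_chart W \<xi> r \<Longrightarrow> W \<subseteq> topspace (leaf_space D)"
  by (simp add: leaf_chart_def openin_subset)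

text \<open>The great arc is traversed with constant speed at most 1 while time advances with speed
  1, so the velocity is causal. The arc stays in the ball by convexity and therefore lifts to
  \<open>W\<close> through the inverse of the chart.\<close>

lemma leaf_chart_precedes:
  assumes chart: "leaf_chart W \<xi> r" and xy: "x \<in> W" "y \<in> W" and ts: "t < s"
    and dist: "round_dist (leaf_dev D x) (leaf_dev D y) \<le> s - t"
  shows "env_precedes D (env_triv D (x, t)) (env_triv D (y, s))"
proof -
  define u v where "u = leaf_dev D x" and "v = leaf_dev D y"
  let ?S = "sphere 0 1 \<inter> ball \<xi> r" and ?h = "inv_into W (leaf_dev D)"
  have r: "0 < r" "r \<le> 1" "norm \<xi> = 1" and inj: "inj_on (leaf_dev D) W" and im: "leaf_dev D ` W = ?S"
    using chart by (auto simp: leaf_chart_def)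
  have "u \<in> ?S" "v \<in> ?S" unfolding u_def v_def im[symmetric] using xy by auto
  then have u: "norm u = 1" "u \<in> ball \<xi> r" and v: "norm v = 1" "v \<in> ball \<xi> r" by auto
  have uv: "- 1 < u \<bullet> v" using sphere_ball_inner_pos[OF r(3,1,2) u v] .
  define \<theta> where "\<theta> = arccos (u \<bullet> v)"
  obtain \<sigma> \<sigma>' where \<sigma>: "\<And>s. (\<sigma> has_vector_derivative \<sigma>' s) (at s)" "continuous_on UNIV \<sigma>'"
    "\<And>s. norm (\<sigma>' s) \<le> 1" "\<And>s. norm (\<sigma> s) = 1" "\<sigma> 0 = u" "\<sigma> \<theta> = v"
    "\<And>s. s \<in> {0..\<theta>} \<Longrightarrow> \<exists>\<alpha> \<beta>. 0 \<le> \<alpha> \<and> 0 \<le> \<beta> \<and> \<sigma> s = \<alpha> *\<^sub>R u + \<beta> *\<^sub>R v"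
    using great_arc[OF u(1) v(1) uv] unfolding \<theta>_def by blast
  define L where "L = s - t"
  \<comment> \<open>The speed at which an arc of length \<open>\<theta>\<close> takes exactly the
    time \<open>L\<close>; it is at most 1 by the hypothesis on the distance.\<close>
  define k where "k = \<theta> / L"
  have L: "0 < L" using ts by (simp add: L_def)
  have \<theta>: "0 \<le> \<theta>" "\<theta> \<le> L"
    using round_dist_nonneg[OF u(1) v(1)] dist by (auto simp: \<theta>_def L_def round_dist_def u_def v_def)
  then have k: "0 \<le> k" "k \<le> 1" "k * L = \<theta>" using L by (auto simp: k_def)
  have mem: "\<sigma> (k * \<tau>) \<in> ?S" if "\<tau> \<in> {0..L}" for \<tau>
  proof -
    have "0 \<le> k * \<tau>" "k * \<tau> \<le> k * L" using that k by (auto intro: mult_left_mono)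
    then have "k * \<tau> \<in> {0..\<theta>}" using k(3) by simp
    then obtain \<alpha> \<beta> where "0 \<le> \<alpha>" "0 \<le> \<beta>" "\<sigma> (k * \<tau>) = \<alpha> *\<^sub>R u + \<beta> *\<^sub>R v" using \<sigma>(7) by blast
    then have "\<sigma> (k * \<tau>) \<in> ball \<xi> r"
      using sphere_ball_convex[OF r(3,1,2) u v \<sigma>(4)] by blast
    then show ?thesis using \<sigma>(4) by simp
  qed
  define \<gamma> where "\<gamma> \<tau> = env_triv D (?h (\<sigma> (k * \<tau>)), t + \<tau>)" for \<tau>
  have fst_\<gamma>: "fst (\<gamma> \<tau>) = (\<sigma> (k * \<tau>), t + \<tau>)" if "\<tau> \<in> {0..L}" for \<tau>
  proof -
    have "leaf_dev D (?h (\<sigma> (k * \<tau>))) = \<sigma> (k * \<tau>)"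
      using mem[OF that] unfolding im[symmetric] by (rule f_inv_into_f)
    then show ?thesis by (simp add: \<gamma>_def env_triv_def)
  qed
  have cont: "continuous_on UNIV \<sigma>"
    using \<sigma>(1) by (meson continuous_at_imp_continuous_on has_vector_derivative_continuous)
  have "C1_ein_causal_curve (\<lambda>\<tau>. (\<sigma> (k * \<tau>), t + \<tau>)) 0 L"
    unfolding C1_ein_causal_curve_def
  proof (intro conjI exI[of _ "\<lambda>\<tau>. (k *\<^sub>R \<sigma>' (k * \<tau>), 1)"] ballI)
    show "(\<lambda>\<tau>. (\<sigma> (k * \<tau>), t + \<tau>)) ` {0..L} \<subseteq> Ein" using \<sigma>(4) by (auto simp: Ein_def)
    show "continuous_on {0..L} (\<lambda>\<tau>. (k *\<^sub>R \<sigma>' (k * \<tau>), 1 :: real))"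
      by (intro continuous_intros continuous_on_compose2[OF \<sigma>(2)]) auto
    fix \<tau>
    have "((\<lambda>\<tau>. k * \<tau>) has_vector_derivative k) (at \<tau>)"
      by (auto intro!: derivative_eq_intros)
    then have "((\<sigma> \<circ> (\<lambda>\<tau>. k * \<tau>)) has_vector_derivative k *\<^sub>R \<sigma>' (k * \<tau>)) (at \<tau>)"
      using \<sigma>(1) by (intro vector_diff_chain_at)
    then have "((\<lambda>\<tau>. \<sigma> (k * \<tau>)) has_vector_derivative k *\<^sub>R \<sigma>' (k * \<tau>)) (at \<tau> within {0..L})"
      unfolding o_def by (rule has_vector_derivative_at_within)
    moreover have "((\<lambda>\<tau>. t + \<tau>) has_vector_derivative 1) (at \<tau> within {0..L})"
      by (auto intro!: derivative_eq_intros)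
    ultimately show "((\<lambda>\<tau>. (\<sigma> (k * \<tau>), t + \<tau>)) has_vector_derivative (k *\<^sub>R \<sigma>' (k * \<tau>), 1)) (at \<tau> within {0..L})"
      by (rule has_vector_derivative_Pair)
    have "k *\<^sub>R \<sigma>' (k * \<tau>) \<bullet> k *\<^sub>R \<sigma>' (k * \<tau>) = (norm (k *\<^sub>R \<sigma>' (k * \<tau>)))\<^sup>2"
      by (simp only: power2_norm_eq_inner)
    also have "\<dots> \<le> 1"
      using k \<sigma>(3)[of "k * \<tau>"] by (simp add: power_le_one mult_le_one)
    finally show "ein_form (k *\<^sub>R \<sigma>' (k * \<tau>), 1) (k *\<^sub>R \<sigma>' (k * \<tau>), 1) \<le> 0"
      by (simp add: ein_form_def)
  qed (auto simp: ein_form_def zero_prod_def)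
  then have "C1_ein_causal_curve (fst \<circ> \<gamma>) 0 L"
    by (rule C1_ein_causal_curve_cong) (simp add: fst_\<gamma>)
  then have "ein_causal_curve (fst \<circ> \<gamma>) 0 L"
    unfolding ein_causal_curve_def using L by (rule piecewise_single)
  moreover have "continuous_map (top_of_set {0..L}) (env_space D) \<gamma>"
  proof -
    have "continuous_map (top_of_set {0..L}) (top_of_set ?S) (\<lambda>\<tau>. \<sigma> (k * \<tau>))"
      using mem by (auto simp: continuous_map_in_subtopology
          intro!: continuous_intros continuous_on_compose2[OF cont])
    then have "continuous_map (top_of_set {0..L}) (leaf_space D) (?h \<circ> (\<lambda>\<tau>. \<sigma> (k * \<tau>)))"
      using leaf_chart_inverse[OF chart] by (rule continuous_map_compose)
    moreover have "continuous_map (top_of_set {0..L}) euclideanreal (\<lambda>\<tau>. t + \<tau>)"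
      by (auto intro!: continuous_intros)
    ultimately have "continuous_map (top_of_set {0..L}) (prod_topology (leaf_space D) euclideanreal)
        (\<lambda>\<tau>. (?h (\<sigma> (k * \<tau>)), t + \<tau>))"
      by (intro continuous_map_pairedI) (auto simp: o_def)
    from continuous_map_compose[OF this continuous_map_env_triv] show ?thesis
      by (simp add: \<gamma>_def[abs_def] o_def)
  qed
  ultimately have "env_causal_curve D \<gamma> 0 L" by (simp add: env_causal_curve_def)
  moreover have "\<gamma> 0 = env_triv D (x, t)"
    using inv_into_f_f[OF inj xy(1)] by (simp add: \<gamma>_def \<sigma>(5) u_def)
  moreover have "\<gamma> L = env_triv D (y, s)"
    using inv_into_f_f[OF inj xy(2)] by (simp add: \<gamma>_def k(3) \<sigma>(6) v_def) (simp add: L_def)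
  ultimately show ?thesis unfolding env_precedes_def by blast
qed

lemma vertical_precedes:
  assumes "b \<in> topspace (leaf_space D)" "t < s"
  shows "env_precedes D (env_triv D (b, t)) (env_triv D (b, s))"
proof -
  obtain W r where "leaf_chart W (leaf_dev D b) r" "b \<in> W" using ex_leaf_chart[OF assms(1)] .
  then show ?thesis
    using assms round_dist_self[OF norm_leaf_dev[OF assms(1)]] by (intro leaf_chart_precedes) auto
qed

lemma ex_round_nbhd:
  assumes "x \<in> topspace (leaf_space D)" "0 < \<epsilon>"
  obtains W r N where "leaf_chart W (leaf_dev D x) r" "openin (leaf_space D) N" "x \<in> N" "N \<subseteq> W"
    "\<And>y. y \<in> N \<Longrightarrow> round_dist (leaf_dev D x) (leaf_dev D y) < \<epsilon>"
proof -
  obtain W r where W: "leaf_chart W (leaf_dev D x) r" "x \<in> W" using ex_leaf_chart[OF assms(1)] .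
  let ?f = "\<lambda>\<eta>. round_dist (leaf_dev D x) \<eta>"
  have nx: "norm (leaf_dev D x) = 1" using assms(1) by (rule norm_leaf_dev)
  have "continuous_on (sphere 0 1) ?f"
    unfolding round_dist_def using abs_inner_sphere_le[OF nx]
    by (intro continuous_intros ballI) (auto simp: abs_le_iff)
  then have "openin (top_of_set (sphere 0 1)) (sphere 0 1 \<inter> ?f -` {..<\<epsilon>})"
    by (rule continuous_openin_preimage_gen) simp
  then have "openin (leaf_space D)
      {y \<in> topspace (leaf_space D). leaf_dev D y \<in> sphere 0 1 \<inter> ?f -` {..<\<epsilon>}}"
    by (rule openin_continuous_map_preimage[OF continuous_map_leaf_dev])
  moreover have "openin (leaf_space D) W" using W(1) by (simp add: leaf_chart_def)
  ultimately show ?thesis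
    using W assms nx round_dist_self[OF nx]
    by (intro that[OF W(1), of "{y \<in> topspace (leaf_space D). leaf_dev D y \<in> sphere 0 1 \<inter> ?f -` {..<\<epsilon>}} \<inter> W"])
      (auto intro: openin_Int)
qed

text \<open>A Lebesgue number argument: charts of half the radius cover \<open>B\<close>, each point
  of a halved chart has a ball of the remaining half inside the full chart, and finitely many radii
  have a positive minimum.\<close>

lemma compact_uniform_chart:
  assumes "compactin (leaf_space D) B"
  obtains \<epsilon> where "0 < \<epsilon>" "\<And>b. b \<in> B \<Longrightarrow>
    \<exists>W \<xi> r. leaf_chart W \<xi> r \<and> b \<in> W \<and> sphere 0 1 \<inter> ball (leaf_dev D b) \<epsilon> \<subseteq> leaf_dev D ` W"
proof -
  have BT: "B \<subseteq> topspace (leaf_space D)" using assms by (rule compactin_subset_topspace)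
  have "\<forall>c\<in>B. \<exists>W r. leaf_chart W (leaf_dev D c) r \<and> c \<in> W"
    using ex_leaf_chart BT by blast
  then obtain W r where W: "\<And>c. c \<in> B \<Longrightarrow> leaf_chart (W c) (leaf_dev D c) (r c)" "\<And>c. c \<in> B \<Longrightarrow> c \<in> W c"
    by metis
  define O' where "O' c = {x \<in> topspace (leaf_space D).
    leaf_dev D x \<in> sphere 0 1 \<inter> ball (leaf_dev D c) (r c / 2)} \<inter> W c" for c
  have "openin (leaf_space D) (O' c)" if "c \<in> B" for c
    unfolding O'_def using W(1)[OF that]
    by (intro openin_Int openin_continuous_map_preimage[OF continuous_map_leaf_dev] openin_open_Int)
      (auto simp: leaf_chart_def)
  moreover have "c \<in> O' c" if "c \<in> B" for c
    using W(1,2)[OF that] that BT norm_leaf_dev by (auto simp: O'_def leaf_chart_def)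
  ultimately have "\<exists>\<F>. finite \<F> \<and> \<F> \<subseteq> O' ` B \<and> B \<subseteq> \<Union>\<F>"
    by (intro compactinD[OF assms]) auto
  then obtain F where F: "finite F" "F \<subseteq> B" "B \<subseteq> \<Union>(O' ` F)"
    by (metis finite_subset_image)
  \<comment> \<open>The added 1 keeps the set nonempty when the cover is empty.\<close>
  define \<epsilon> where "\<epsilon> = Min (insert 1 ((\<lambda>c. r c / 2) ` F))"
  have \<epsilon>: "\<epsilon> \<le> r c / 2" if "c \<in> F" for c
    unfolding \<epsilon>_def using F(1) that by (intro Min_le) auto
  have "0 < \<epsilon>" unfolding \<epsilon>_def using F(1,2) W(1) by (auto simp: leaf_chart_def)
  moreover have "\<exists>W \<xi> r. leaf_chart W \<xi> r \<and> b \<in> W \<and> sphere 0 1 \<inter> ball (leaf_dev D b) \<epsilon> \<subseteq> leaf_dev D ` W"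
    if b: "b \<in> B" for b
  proof -
    obtain c where c: "c \<in> F" "b \<in> O' c" using F(3) b by blast
    then have ch: "leaf_chart (W c) (leaf_dev D c) (r c)" using W(1) F(2) by blast
    have "ball (leaf_dev D b) \<epsilon> \<subseteq> ball (leaf_dev D c) (r c)"
    proof
      fix z assume "z \<in> ball (leaf_dev D b) \<epsilon>"
      then have "dist (leaf_dev D b) z < r c / 2" using \<epsilon>[OF c(1)] by simp
      moreover have "dist (leaf_dev D c) (leaf_dev D b) < r c / 2" using c(2) by (simp add: O'_def)
      ultimately show "z \<in> ball (leaf_dev D c) (r c)"
        using dist_triangle[of "leaf_dev D c" z "leaf_dev D b"] by simp
    qed
    then have "sphere 0 1 \<inter> ball (leaf_dev D b) \<epsilon> \<subseteq> leaf_dev D ` W c"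
      using ch by (auto simp: leaf_chart_def)
    moreover have "b \<in> W c" using c(2) by (simp add: O'_def)
    ultimately show ?thesis using ch by blast
  qed
  ultimately show ?thesis by (rule that)
qed

end

section \<open>Causally convex regions\<close>

locale causally_convex_region = ein_development D
  for D :: "'v::t2_space \<Rightarrow> (real ^ 'n::finite) \<times> real" +
  fixes \<Omega> :: "(((real ^ 'n) \<times> real) \<times> 'v set) set"
  assumes open_region: "openin (env_space D) \<Omega>"
    and convex_region: "causally_convex (env_causal_curve D) \<Omega>"
begin

section \<open>Fibres of the region\<close>

definition fibre :: "'v set \<Rightarrow> real set" where
  "fibre b = {t. env_triv D (b, t) \<in> \<Omega>}"

text \<open>The set \<open>U\<close> of the theorem: the projection of \<open>\<Omega>\<close> to
  the leaf space.\<close>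

definition region_base :: "'v set set" where
  "region_base = {b. fibre b \<noteq> {}}"

lemma region_eq: "\<Omega> = env_triv D ` {(b, t). t \<in> fibre b}"
proof
  show "\<Omega> \<subseteq> env_triv D ` {(b, t). t \<in> fibre b}"
  proof
    fix p assume p: "p \<in> \<Omega>"
    then have "p \<in> topspace (env_space D)" using open_region openin_subset by blast
    then have "p = env_triv D (snd p, snd (fst p))" by (rule env_spaceD)
    then show "p \<in> env_triv D ` {(b, t). t \<in> fibre b}"
      using p by (intro image_eqI[of _ _ "(snd p, snd (fst p))"]) (auto simp: fibre_def)
  qed
qed (auto simp: fibre_def)

lemma fibre_topspace: "t \<in> fibre b \<Longrightarrow> b \<in> topspace (leaf_space D)"
  using open_region[THEN openin_subset] env_spaceD(1)[of "env_triv D (b, t)"]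
  by (auto simp: fibre_def env_triv_def)

lemma openin_at_time: "openin (leaf_space D) {b. t \<in> fibre b}"
proof -
  have "continuous_map (leaf_space D) (prod_topology (leaf_space D) euclideanreal) (\<lambda>b. (b, t))"
    by (auto intro!: continuous_map_pairedI)
  from openin_continuous_map_preimage[OF continuous_map_compose[OF this continuous_map_env_triv] open_region]
  have "openin (leaf_space D) {b \<in> topspace (leaf_space D). t \<in> fibre b}"
    by (simp add: fibre_def)
  moreover have "{b \<in> topspace (leaf_space D). t \<in> fibre b} = {b. t \<in> fibre b}"
    using fibre_topspace by blast
  ultimately show ?thesis by simp
qed

lemma openin_region_base: "openin (leaf_space D) region_base"
proof -
  have "region_base = (\<Union>t. {b. t \<in> fibre b})" by (auto simp: region_base_def)
  then show ?thesis using openin_at_time by auto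
qed

lemma open_fibre: "open (fibre b)"
proof (cases "fibre b = {}")
  case False
  then have "b \<in> topspace (leaf_space D)" using fibre_topspace by blast
  then have "continuous_map euclideanreal (prod_topology (leaf_space D) euclideanreal) (\<lambda>t. (b, t))"
    by (auto intro!: continuous_map_pairedI)
  from openin_continuous_map_preimage[OF continuous_map_compose[OF this continuous_map_env_triv] open_region]
  show ?thesis by (simp add: fibre_def)
qed simp

lemma fibre_between:
  assumes "t \<in> fibre x" "s \<in> fibre z"
    and "env_precedes D (env_triv D (x, t)) (env_triv D (y, u))"
    and "env_precedes D (env_triv D (y, u)) (env_triv D (z, s))"
  shows "u \<in> fibre y"
  using causally_convexD[OF convex_region _ _ assms(3,4)] assms(1,2) by (simp add: fibre_def)

lemma fibre_interval:
  assumes "t \<in> fibre b" "s \<in> fibre b" "t \<le> u" "u \<le> s"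
  shows "u \<in> fibre b"
proof (cases "u = t \<or> u = s")
  case False
  have "b \<in> topspace (leaf_space D)" using assms(1) fibre_topspace by blast
  then show ?thesis
    using False assms by (intro fibre_between[OF assms(1,2)] vertical_precedes) auto
qed (use assms in auto)

text \<open>Fibres are open, so they do not attain their ends, and they contain every time between
  two of their own. Boundedness stays a hypothesis until \<open>bounded_fibre\<close>, where the
  absence of conjugate points supplies it.\<close>

lemma fibre_eq_Inf_Sup:
  assumes "b \<in> region_base" "bounded (fibre b)"
  shows "fibre b = {Inf (fibre b)<..<Sup (fibre b)}"
proof -
  have ne: "fibre b \<noteq> {}" using assms(1) by (simp add: region_base_def)
  have bdd: "bdd_above (fibre b)" "bdd_below (fibre b)"
    using assms(2) by (auto intro: bounded_imp_bdd_above bounded_imp_bdd_below)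
  show ?thesis
  proof (intro set_eqI iffI)
    fix t assume t: "t \<in> fibre b"
    then obtain e where e: "0 < e" "ball t e \<subseteq> fibre b" using open_fibre by (meson open_contains_ball)
    then have "t - e / 2 \<in> fibre b" "t + e / 2 \<in> fibre b" by (auto simp: dist_real_def subset_iff)
    then have "Inf (fibre b) \<le> t - e / 2" "t + e / 2 \<le> Sup (fibre b)"
      using bdd by (auto intro: cInf_lower cSup_upper)
    then show "t \<in> {Inf (fibre b)<..<Sup (fibre b)}" using e(1) by auto
  next
    fix t assume "t \<in> {Inf (fibre b)<..<Sup (fibre b)}"
    then obtain r s where "r \<in> fibre b" "r < t" "s \<in> fibre b" "t < s"
      using cInf_lessD[OF ne] less_cSupD[OF ne] by (metis greaterThanLessThan_iff)
    then show "t \<in> fibre b" using fibre_interval by (meson less_imp_le)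
  qed
qed

text \<open>If \<open>s - \<delta>\<close> exceeded \<open>Sup (fibre y)\<close>, a time
  \<open>u\<close> strictly between them would give a point over \<open>y\<close> that is above time
  \<open>t0\<close> on its leaf and below \<open>(x, s)\<close> in the chart; convexity would put
  \<open>u\<close> into \<open>fibre y\<close>. The common time \<open>t0\<close> serves as the
  other end of the diamond. The infimum is treated symmetrically.\<close>

lemma fibre_shrink:
  assumes chart: "leaf_chart W \<xi> r" "x \<in> W" "y \<in> W" and t0: "t0 \<in> fibre x" "t0 \<in> fibre y"
  defines "\<delta> \<equiv> round_dist (leaf_dev D x) (leaf_dev D y)"
  assumes bdd: "bounded (fibre y)"
  shows "s \<in> fibre x \<Longrightarrow> s - \<delta> \<le> Sup (fibre y)" "s \<in> fibre x \<Longrightarrow> Inf (fibre y) \<le> s + \<delta>"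
proof -
  have top: "x \<in> topspace (leaf_space D)" "y \<in> topspace (leaf_space D)"
    using t0 fibre_topspace by blast+
  have \<delta>: "0 \<le> \<delta>" unfolding \<delta>_def using top norm_leaf_dev round_dist_nonneg by blast
  have up: "u \<le> Sup (fibre y)" and low: "Inf (fibre y) \<le> u" if "u \<in> fibre y" for u
    using that bdd by (auto intro: cSup_upper cInf_lower bounded_imp_bdd_above bounded_imp_bdd_below)
  note prec = leaf_chart_precedes[OF chart(1)]
  show "s - \<delta> \<le> Sup (fibre y)" if s: "s \<in> fibre x"
  proof (rule ccontr)
    assume "\<not> ?thesis"
    then have less: "Sup (fibre y) < s - \<delta>" by simp
    define u where "u = (Sup (fibre y) + (s - \<delta>)) / 2"
    have u: "Sup (fibre y) < u" "u < s - \<delta>" using less by (auto simp: u_def field_simps)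
    have "t0 < u" using up[OF t0(2)] u by simp
    have "u \<in> fibre y"
    proof (rule fibre_between[OF t0(2) s])
      show "env_precedes D (env_triv D (y, t0)) (env_triv D (y, u))"
        using top \<open>t0 < u\<close> by (rule_tac vertical_precedes) auto
      show "env_precedes D (env_triv D (y, u)) (env_triv D (x, s))"
        using u \<delta> chart by (intro prec) (auto simp: \<delta>_def round_dist_commute)
    qed
    then show False using up[of u] u by simp
  qed
  show "Inf (fibre y) \<le> s + \<delta>" if s: "s \<in> fibre x"
  proof (rule ccontr)
    assume "\<not> ?thesis"
    then have less: "s + \<delta> < Inf (fibre y)" by simp
    define u where "u = (Inf (fibre y) + (s + \<delta>)) / 2"
    have u: "u < Inf (fibre y)" "s + \<delta> < u" using less by (auto simp: u_def field_simps)
    have "u < t0" using low[OF t0(2)] u by simp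
    have "u \<in> fibre y"
    proof (rule fibre_between[OF s t0(2)])
      show "env_precedes D (env_triv D (y, u)) (env_triv D (y, t0))"
        using top \<open>u < t0\<close> by (rule_tac vertical_precedes) auto
      show "env_precedes D (env_triv D (x, s)) (env_triv D (y, u))"
        using u \<delta> chart by (intro prec) (auto simp: \<delta>_def)
    qed
    then show False using low[of u] u by simp
  qed
qed

text \<open>The shrinking bounds also hold with \<open>x\<close> and \<open>y\<close> exchanged;
  passing to the supremum or infimum over \<open>s\<close> gives two-sided estimates.\<close>

lemma Sup_Inf_fibre_lipschitz:
  assumes chart: "leaf_chart W \<xi> r" "x \<in> W" "y \<in> W" and t0: "t0 \<in> fibre x" "t0 \<in> fibre y"
    and bdd: "bounded (fibre x)" "bounded (fibre y)"
  shows "\<bar>Sup (fibre x) - Sup (fibre y)\<bar> \<le> round_dist (leaf_dev D x) (leaf_dev D y)"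
    and "\<bar>Inf (fibre x) - Inf (fibre y)\<bar> \<le> round_dist (leaf_dev D x) (leaf_dev D y)"
proof -
  let ?\<delta> = "round_dist (leaf_dev D x) (leaf_dev D y)"
  note xy = fibre_shrink[OF chart t0 bdd(2)]
  note yx = fibre_shrink[OF chart(1,3,2) t0(2,1) bdd(1), unfolded round_dist_commute[of "leaf_dev D y"]]
  have "Sup (fibre x) \<le> Sup (fibre y) + ?\<delta>"
    using t0(1) by (intro cSup_least) (use xy(1) in \<open>auto simp: algebra_simps\<close>)
  moreover have "Sup (fibre y) \<le> Sup (fibre x) + ?\<delta>"
    using t0(2) by (intro cSup_least) (use yx(1) in \<open>auto simp: algebra_simps\<close>)
  ultimately show "\<bar>Sup (fibre x) - Sup (fibre y)\<bar> \<le> ?\<delta>" by linarith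
  have "Inf (fibre y) - ?\<delta> \<le> Inf (fibre x)"
    using t0(1) by (intro cInf_greatest) (use xy(2) in \<open>auto simp: algebra_simps\<close>)
  moreover have "Inf (fibre x) - ?\<delta> \<le> Inf (fibre y)"
    using t0(2) by (intro cInf_greatest) (use yx(2) in \<open>auto simp: algebra_simps\<close>)
  ultimately show "\<bar>Inf (fibre x) - Inf (fibre y)\<bar> \<le> ?\<delta>" by linarith
qed

lemma ex_lipschitz_nbhd:
  assumes bdd: "\<And>b. bounded (fibre b)" and x: "x \<in> region_base"
  obtains W where "openin (leaf_space D) W" "x \<in> W" "W \<subseteq> region_base" "inj_on (leaf_dev D) W"
    "\<And>y z. y \<in> W \<Longrightarrow> z \<in> W \<Longrightarrow>
       \<bar>Sup (fibre y) - Sup (fibre z)\<bar> \<le> round_dist (leaf_dev D y) (leaf_dev D z)"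
    "\<And>y z. y \<in> W \<Longrightarrow> z \<in> W \<Longrightarrow>
       \<bar>Inf (fibre y) - Inf (fibre z)\<bar> \<le> round_dist (leaf_dev D y) (leaf_dev D z)"
proof -
  obtain t0 where t0: "t0 \<in> fibre x" using x by (auto simp: region_base_def)
  obtain W r where W: "leaf_chart W (leaf_dev D x) r" "x \<in> W"
    using ex_leaf_chart fibre_topspace[OF t0] .
  \<comment> \<open>A time over \<open>x\<close> persists at nearby points: on this set
    \<open>t0\<close> is common to all fibres, as the Lipschitz estimate demands.\<close>
  let ?W = "W \<inter> {y. t0 \<in> fibre y}"
  show ?thesis
  proof (rule that[of ?W])
    show "openin (leaf_space D) ?W"
      using W(1) openin_at_time by (auto simp: leaf_chart_def intro: openin_Int)
    show "inj_on (leaf_dev D) ?W"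
      using W(1) by (auto simp: leaf_chart_def intro: inj_on_subset)
    show "\<bar>Sup (fibre y) - Sup (fibre z)\<bar> \<le> round_dist (leaf_dev D y) (leaf_dev D z)"
      "\<bar>Inf (fibre y) - Inf (fibre z)\<bar> \<le> round_dist (leaf_dev D y) (leaf_dev D z)"
      if "y \<in> ?W" "z \<in> ?W" for y z
      using Sup_Inf_fibre_lipschitz[OF W(1), of y z t0] that bdd by auto
  qed (use W t0 in \<open>auto simp: region_base_def\<close>)
qed

lemma one_lipschitz_Sup_Inf:
  assumes "\<And>b. bounded (fibre b)"
  shows "one_lipschitz D region_base (\<lambda>b. Sup (fibre b))"
    and "one_lipschitz D region_base (\<lambda>b. Inf (fibre b))"
  unfolding one_lipschitz_def
  by (rule ballI, rule ex_lipschitz_nbhd[OF assms], assumption, intro exI conjI, assumption+,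
      simp add: inv_into_f_f)+

text \<open>With a larger gap some \<open>(x, u)\<close> would lie above \<open>(y, t)\<close> and
  below \<open>(z, s)\<close>, hence in \<open>\<Omega>\<close>, and \<open>x\<close> would belong
  to \<open>region_base\<close>.\<close>

lemma fibre_distance_outside:
  assumes "leaf_chart W \<xi> r" "x \<in> W" "y \<in> W" "z \<in> W" "x \<notin> region_base" "t \<in> fibre y" "s \<in> fibre z"
  shows "s - t \<le> round_dist (leaf_dev D x) (leaf_dev D y) + round_dist (leaf_dev D x) (leaf_dev D z)"
proof (rule ccontr)
  let ?a = "round_dist (leaf_dev D x) (leaf_dev D y)" and ?b = "round_dist (leaf_dev D x) (leaf_dev D z)"
  assume "\<not> ?thesis"
  then have less: "?a + ?b < s - t" by simp
  have top: "x \<in> topspace (leaf_space D)" "y \<in> topspace (leaf_space D)" "z \<in> topspace (leaf_space D)"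
    using assms(1-4) leaf_chart_subset_topspace by blast+
  then have nn: "0 \<le> ?a" "0 \<le> ?b" using norm_leaf_dev round_dist_nonneg by blast+
  \<comment> \<open>The midpoint between \<open>t + ?a\<close> and \<open>s - ?b\<close>, so that
    both precedences hold with room to spare.\<close>
  define u where "u = (t + ?a + (s - ?b)) / 2"
  have u: "t + ?a < u" "u + ?b < s" using less by (auto simp: u_def field_simps)
  have "u \<in> fibre x"
  proof (rule fibre_between[OF assms(6,7)])
    show "env_precedes D (env_triv D (y, t)) (env_triv D (x, u))"
      using u nn by (intro leaf_chart_precedes[OF assms(1,3,2)]) (auto simp: round_dist_commute)
    show "env_precedes D (env_triv D (x, u)) (env_triv D (z, s))"
      using u nn by (intro leaf_chart_precedes[OF assms(1,2,4)]) auto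
  qed
  then show False using assms(5) by (auto simp: region_base_def)
qed

text \<open>Each of \<open>y\<close> and \<open>z\<close> contributes at most
  \<open>\<epsilon> / 2\<close> to the time gap. Closures are taken so that the estimate reaches the
  suprema and infima of the fibres.\<close>

lemma fibres_collapse_outside:
  assumes x: "x \<in> topspace (leaf_space D)" "x \<notin> region_base" and \<epsilon>: "0 < \<epsilon>"
  obtains N where "openin (leaf_space D) N" "x \<in> N"
    "\<And>y z t s. y \<in> N \<Longrightarrow> z \<in> N \<Longrightarrow> t \<in> closure (fibre y) \<Longrightarrow> s \<in> closure (fibre z) \<Longrightarrow> \<bar>t - s\<bar> \<le> \<epsilon>"
proof -
  obtain W r N where N: "leaf_chart W (leaf_dev D x) r" "openin (leaf_space D) N" "x \<in> N" "N \<subseteq> W"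
    "\<And>y. y \<in> N \<Longrightarrow> round_dist (leaf_dev D x) (leaf_dev D y) < \<epsilon> / 2"
    by (rule ex_round_nbhd[OF x(1) half_gt_zero[OF \<epsilon>]]) blast
  have le: "s - t \<le> \<epsilon>" if "y \<in> N" "z \<in> N" "t \<in> fibre y" "s \<in> fibre z" for y z t s
  proof -
    have "x \<in> W" "y \<in> W" "z \<in> W" using N(3,4) that by blast+
    then show ?thesis
      using fibre_distance_outside[OF N(1) _ _ _ x(2) that(3,4)] N(5)[OF that(1)] N(5)[OF that(2)] by simp
  qed
  have "\<bar>t - s\<bar> \<le> \<epsilon>"
    if yz: "y \<in> N" "z \<in> N" and ts: "t \<in> closure (fibre y)" "s \<in> closure (fibre z)" for y z t s
  proof -
    have "dist t s \<le> \<epsilon>"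
    proof (rule dist_closure_le[OF _ ts])
      fix t s assume "t \<in> fibre y" "s \<in> fibre z"
      then have "s - t \<le> \<epsilon>" "t - s \<le> \<epsilon>" using le yz by blast+
      then show "dist t s \<le> \<epsilon>" by (simp add: dist_real_def)
    qed
    then show ?thesis by (simp add: dist_real_def)
  qed
  then show ?thesis by (rule that[OF N(2,3)])
qed

section \<open>Extensions to the frontier\<close>

lemma Sup_Inf_mem_closure_fibre:
  assumes "bounded (fibre b)" "b \<in> region_base"
  shows "Sup (fibre b) \<in> closure (fibre b)" "Inf (fibre b) \<in> closure (fibre b)"
  using assms by (auto simp: region_base_def intro!: closure_contains_Sup closure_contains_Inf
      bounded_imp_bdd_above bounded_imp_bdd_below)

text \<open>Serves both ends of the fibres. The oscillation of \<open>f\<close> is controlled by the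
  Lipschitz bound at points of \<open>region_base\<close> and by the collapse of the fibres at the
  remaining points of the closure.\<close>

lemma ex_continuous_extension:
  assumes "\<And>b. b \<in> region_base \<Longrightarrow> f b \<in> closure (fibre b)"
    and lip: "one_lipschitz D region_base f"
  obtains h where "continuous_extension (leaf_space D) region_base f h"
proof (rule continuous_extension_closure[OF openin_subset[OF openin_region_base], of f])
  fix x and \<epsilon> :: real assume x: "x \<in> leaf_space D closure_of region_base" and \<epsilon>: "0 < \<epsilon>"
  then have top: "x \<in> topspace (leaf_space D)" by (simp add: in_closure_of)
  show "\<exists>N. openin (leaf_space D) N \<and> x \<in> N \<and>
      (\<forall>y\<in>N \<inter> region_base. \<forall>z\<in>N \<inter> region_base. \<bar>f y - f z\<bar> \<le> \<epsilon>)"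
  proof (cases "x \<in> region_base")
    case True
    then obtain W where W: "openin (leaf_space D) W" "x \<in> W" "inj_on (leaf_dev D) W"
      "\<forall>y\<in>leaf_dev D ` W. \<forall>z\<in>leaf_dev D ` W.
         \<bar>f (inv_into W (leaf_dev D) y) - f (inv_into W (leaf_dev D) z)\<bar> \<le> round_dist y z"
      using lip unfolding one_lipschitz_def by blast
    have W': "\<bar>f y - f z\<bar> \<le> round_dist (leaf_dev D y) (leaf_dev D z)" if "y \<in> W" "z \<in> W" for y z
      using W(4) that by (simp add: inv_into_f_f[OF W(3)])
    obtain N where N: "openin (leaf_space D) N" "x \<in> N"
      "\<And>y. y \<in> N \<Longrightarrow> round_dist (leaf_dev D x) (leaf_dev D y) < \<epsilon> / 2"
      by (rule ex_round_nbhd[OF top half_gt_zero[OF \<epsilon>]]) blast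
    have "\<bar>f y - f z\<bar> \<le> \<epsilon>" if "y \<in> W \<inter> N" "z \<in> W \<inter> N" for y z
      using W'[of x y] W'[of x z] N(3)[of y] N(3)[of z] W(2) that by simp
    moreover have "openin (leaf_space D) (W \<inter> N)" using W(1) N(1) by (rule openin_Int)
    ultimately show ?thesis using W(2) N(2) by (intro exI[of _ "W \<inter> N"]) simp
  next
    case False
    obtain N where "openin (leaf_space D) N" "x \<in> N"
      "\<And>y z t s. y \<in> N \<Longrightarrow> z \<in> N \<Longrightarrow> t \<in> closure (fibre y) \<Longrightarrow> s \<in> closure (fibre z) \<Longrightarrow> \<bar>t - s\<bar> \<le> \<epsilon>"
      using fibres_collapse_outside[OF top False \<epsilon>] by blast
    then show ?thesis using assms(1) by (intro exI[of _ N] conjI ballI) blast+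
  qed
qed (rule that)

lemma Sup_Inf_extensions:
  assumes bdd: "\<And>b. bounded (fibre b)"
  obtains h k where "continuous_extension (leaf_space D) region_base (\<lambda>b. Sup (fibre b)) h"
    "continuous_extension (leaf_space D) region_base (\<lambda>b. Inf (fibre b)) k"
    "\<And>x. x \<in> leaf_space D frontier_of region_base \<Longrightarrow> h x = k x"
proof -
  note mem = Sup_Inf_mem_closure_fibre[OF bdd]
  obtain h where h: "continuous_extension (leaf_space D) region_base (\<lambda>b. Sup (fibre b)) h"
    using ex_continuous_extension[OF mem(1) one_lipschitz_Sup_Inf(1)[OF bdd]] by blast
  obtain k where k: "continuous_extension (leaf_space D) region_base (\<lambda>b. Inf (fibre b)) k"
    using ex_continuous_extension[OF mem(2) one_lipschitz_Sup_Inf(2)[OF bdd]] by blast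
  have "h x = k x" if "x \<in> leaf_space D frontier_of region_base" for x
  proof (rule continuous_extension_eq[OF h k])
    have x: "x \<in> leaf_space D closure_of region_base" "x \<notin> region_base"
      using that openin_region_base by (auto simp: frontier_of_openin)
    then show "x \<in> leaf_space D closure_of region_base" by simp
    have top: "x \<in> topspace (leaf_space D)" using x by (simp add: in_closure_of)
    fix \<epsilon> :: real assume "0 < \<epsilon>"
    from fibres_collapse_outside[OF top x(2) this]
    obtain N where "openin (leaf_space D) N" "x \<in> N"
      "\<And>y z t s. y \<in> N \<Longrightarrow> z \<in> N \<Longrightarrow> t \<in> closure (fibre y) \<Longrightarrow> s \<in> closure (fibre z) \<Longrightarrow> \<bar>t - s\<bar> \<le> \<epsilon>"
      by blast
    \<comment> \<open>The collapse is used with both points equal, which compares the two ends of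
      one fibre.\<close>
    then show "\<exists>N. openin (leaf_space D) N \<and> x \<in> N \<and>
        (\<forall>y\<in>N \<inter> region_base. \<bar>Sup (fibre y) - Inf (fibre y)\<bar> \<le> \<epsilon>)"
      using mem by (intro exI[of _ N]) auto
  qed
  then show ?thesis using that h k by blast
qed

text \<open>A point between the two given ones lies in \<open>\<Omega>\<close> by convexity, and so
  do the connecting curves; hence it belongs to the compact diamond of \<open>\<Omega>\<close>,
  which is then projected to the leaf space.\<close>

lemma compactin_diamond_base:
  assumes gh: "globally_hyperbolic (subtopology (env_space D) \<Omega>) (curves_in \<Omega> (env_causal_curve D))"
    and b: "t \<in> fibre b" "t' \<in> fibre b"
  obtains B where "compactin (leaf_space D) B"
    "\<And>\<beta> u. env_precedes D (env_triv D (b, t)) (env_triv D (\<beta>, u)) \<Longrightarrow>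
      env_precedes D (env_triv D (\<beta>, u)) (env_triv D (b, t')) \<Longrightarrow> \<beta> \<in> B"
proof -
  let ?p = "env_triv D (b, t)" and ?q = "env_triv D (b, t')"
  let ?T = "subtopology (env_space D) \<Omega>" and ?C = "curves_in \<Omega> (env_causal_curve D)"
  have \<Omega>: "?p \<in> \<Omega>" "?q \<in> \<Omega>" using b by (auto simp: fibre_def)
  have top: "topspace ?T = \<Omega>" using openin_subset[OF open_region] by auto
  define K where "K = causal_past ?T ?C ?q \<inter> causal_future ?T ?C ?p"
  have "compactin ?T K" using gh \<Omega> top by (simp add: globally_hyperbolic_def K_def)
  then have "compactin (env_space D) K" by (simp add: compactin_subtopology)
  moreover have "continuous_map (env_space D) (leaf_space D) snd"
    unfolding env_space_def by (intro continuous_map_from_subtopology continuous_map_snd)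
  ultimately have "compactin (leaf_space D) (snd ` K)" by (rule image_compactin)
  moreover have "\<beta> \<in> snd ` K"
    if pre: "env_precedes D ?p (env_triv D (\<beta>, u))" "env_precedes D (env_triv D (\<beta>, u)) ?q" for \<beta> u
  proof -
    have r: "env_triv D (\<beta>, u) \<in> \<Omega>" using causally_convexD[OF convex_region \<Omega> pre] .
    have "env_triv D (\<beta>, u) \<in> K"
      using causally_convex_curves_in[OF convex_region \<Omega>(1) r pre(1)]
        causally_convex_curves_in[OF convex_region r \<Omega>(2) pre(2)] r top
      unfolding K_def causal_past_def causal_future_def by blast
    then show ?thesis by (force simp: env_triv_def)
  qed
  ultimately show ?thesis by (rule that)
qed

text \<open>A continuation argument: the lift of the great circle advances in steps of uniform
  length. Up to the parameter \<open>pi\<close> it stays in the compact projection of a diamond, and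
  compactness supplies the step length.\<close>

lemma fibre_length_le:
  assumes card: "CARD('n) \<ge> 2"
    and gh: "globally_hyperbolic (subtopology (env_space D) \<Omega>) (curves_in \<Omega> (env_causal_curve D))"
    and nc: "\<not> (\<exists>p\<in>\<Omega>. \<exists>q\<in>\<Omega>. env_conjugate p q)"
    and t: "t \<in> fibre b" "t' \<in> fibre b"
  shows "t' - t \<le> 2 * pi"
proof (rule ccontr)
  assume "\<not> ?thesis"
  then have long: "2 * pi < t' - t" by simp
  \<comment> \<open>Half of the excess: for \<open>s \<le> pi\<close> the time
    \<open>t + s + \<delta>\<close> is more than \<open>s\<close> after \<open>t\<close> and more
    than \<open>s\<close> before \<open>t'\<close>.\<close>
  define \<delta> where "\<delta> = (t' - t - 2 * pi) / 2"
  have \<delta>: "0 < \<delta>" "t + \<delta> + 2 * pi < t'" using long by (auto simp: \<delta>_def field_simps)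
  have top: "b \<in> topspace (leaf_space D)" using t fibre_topspace by blast
  define u where "u = leaf_dev D b"
  have u: "norm u = 1" using top norm_leaf_dev by (simp add: u_def)
  \<comment> \<open>A direction for the great circle at \<open>u\<close>; the ambient dimension is
    at least 2.\<close>
  obtain v where "v \<noteq> 0" "orthogonal u v"
    using orthogonal_to_vector_exists[of u] card by auto
  define e where "e = v /\<^sub>R norm v"
  have e: "norm e = 1" "u \<bullet> e = 0" using \<open>v \<noteq> 0\<close> \<open>orthogonal u v\<close> by (auto simp: e_def orthogonal_def)
  note ue = u e
  let ?\<sigma> = "great_circle u e"
  \<comment> \<open>\<open>s < \<tau>\<close> is strict because \<open>env_precedes\<close> does not relate a point to itself, which matters
    for \<open>s = 0\<close>.\<close>
  define Q where "Q s \<beta> \<longleftrightarrow> leaf_dev D \<beta> = ?\<sigma> s \<and> \<beta> \<in> topspace (leaf_space D) \<and>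
    (\<forall>r \<tau>. s < \<tau> \<longrightarrow> env_precedes D (env_triv D (b, r)) (env_triv D (\<beta>, r + \<tau>)) \<and>
       env_precedes D (env_triv D (\<beta>, r)) (env_triv D (b, r + \<tau>)))" for s \<beta>
  have in_diamond: "env_precedes D (env_triv D (b, t)) (env_triv D (\<beta>, t + s + \<delta>))"
    "env_precedes D (env_triv D (\<beta>, t + s + \<delta>)) (env_triv D (b, t'))" if "Q s \<beta>" "s \<le> pi" for s \<beta>
  proof -
    have "s < s + \<delta>" "s < t' - (t + s + \<delta>)" using \<delta> that(2) by auto
    then have "env_precedes D (env_triv D (b, t)) (env_triv D (\<beta>, t + (s + \<delta>)))"
      "env_precedes D (env_triv D (\<beta>, t + s + \<delta>)) (env_triv D (b, (t + s + \<delta>) + (t' - (t + s + \<delta>))))"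
      using that(1) unfolding Q_def by blast+
    then show "env_precedes D (env_triv D (b, t)) (env_triv D (\<beta>, t + s + \<delta>))"
      "env_precedes D (env_triv D (\<beta>, t + s + \<delta>)) (env_triv D (b, t'))"
      by (simp_all add: algebra_simps)
  qed
  obtain B where B: "compactin (leaf_space D) B" "\<And>\<beta> u. env_precedes D (env_triv D (b, t)) (env_triv D (\<beta>, u)) \<Longrightarrow>
      env_precedes D (env_triv D (\<beta>, u)) (env_triv D (b, t')) \<Longrightarrow> \<beta> \<in> B"
    using compactin_diamond_base[OF gh t] by blast
  obtain \<epsilon> where \<epsilon>: "0 < \<epsilon>" "\<And>b. b \<in> B \<Longrightarrow>
      \<exists>W \<xi> r. leaf_chart W \<xi> r \<and> b \<in> W \<and> sphere 0 1 \<inter> ball (leaf_dev D b) \<epsilon> \<subseteq> leaf_dev D ` W"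
    using compact_uniform_chart[OF B(1)] by blast
  \<comment> \<open>The point \<open>\<beta>\<close> lies in \<open>B\<close>, so some chart about
    it covers the \<open>\<epsilon>\<close>-ball around its image. That ball contains
    \<open>?\<sigma> s'\<close>, and the point of the chart over it continues the lift.\<close>
  have step: "\<exists>\<beta>'. Q s' \<beta>'" if Q: "Q s \<beta>" and s: "s \<le> s'" "s' \<le> pi" "0 \<le> s" "s' - s < \<epsilon>" for s s' \<beta>
  proof -
    have "s \<le> pi" using s by simp
    then have \<beta>B: "\<beta> \<in> B" using B(2)[OF in_diamond[OF Q]] by blast
    obtain W \<xi> r where W: "leaf_chart W \<xi> r" "\<beta> \<in> W"
      "sphere 0 1 \<inter> ball (leaf_dev D \<beta>) \<epsilon> \<subseteq> leaf_dev D ` W" using \<epsilon>(2)[OF \<beta>B] by blast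
    have d\<beta>: "leaf_dev D \<beta> = ?\<sigma> s" using Q by (simp add: Q_def)
    have "?\<sigma> s' \<in> sphere 0 1 \<inter> ball (leaf_dev D \<beta>) \<epsilon>"
      using dist_great_circle_le[OF ue, of s s'] norm_great_circle[OF ue] s by (simp add: d\<beta>)
    then have "?\<sigma> s' \<in> leaf_dev D ` W" using W(3) by blast
    then obtain \<beta>' where \<beta>': "\<beta>' \<in> W" "leaf_dev D \<beta>' = ?\<sigma> s'" by (metis imageE)
    have dist: "round_dist (leaf_dev D \<beta>) (leaf_dev D \<beta>') = s' - s"
      unfolding d\<beta> \<beta>'(2) using round_dist_great_circle[OF ue] s by simp
    have "env_precedes D (env_triv D (b, r)) (env_triv D (\<beta>', r + \<tau>)) \<and>
       env_precedes D (env_triv D (\<beta>', r)) (env_triv D (b, r + \<tau>))" if less: "s' < \<tau>" for r \<tau>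
    proof -
      \<comment> \<open>The excess of \<open>\<tau>\<close> over \<open>s'\<close> is shared equally
        by the leg between \<open>b\<close> and \<open>\<beta>\<close> and the leg between
        \<open>\<beta>\<close> and \<open>\<beta>'\<close>, since each needs a strict
        margin.\<close>
      obtain \<eta> where \<eta>: "0 < \<eta>" "\<tau> = s' + \<eta> + \<eta>"
      proof
        show "0 < (\<tau> - s') / 2" using less by simp
        show "\<tau> = s' + (\<tau> - s') / 2 + (\<tau> - s') / 2" by (simp add: field_simps)
      qed
      define \<tau>' where "\<tau>' = s' - s + \<eta>"
      have \<tau>': "0 < \<tau>'" "s' - s \<le> \<tau>'" "s < \<tau> - \<tau>'" using s \<eta> by (simp_all add: \<tau>'_def)
      have "env_precedes D (env_triv D (b, r)) (env_triv D (\<beta>, r + (\<tau> - \<tau>')))"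
        using Q \<tau>'(3) unfolding Q_def by blast
      moreover have "env_precedes D (env_triv D (\<beta>, r + (\<tau> - \<tau>'))) (env_triv D (\<beta>', r + \<tau>))"
        using \<tau>' dist by (intro leaf_chart_precedes[OF W(1,2) \<beta>'(1)]) auto
      moreover have "env_precedes D (env_triv D (\<beta>', r)) (env_triv D (\<beta>, r + \<tau>'))"
        using \<tau>' dist by (intro leaf_chart_precedes[OF W(1) \<beta>'(1) W(2)]) (auto simp: round_dist_commute)
      moreover have "env_precedes D (env_triv D (\<beta>, r + \<tau>')) (env_triv D (b, (r + \<tau>') + (\<tau> - \<tau>')))"
        using Q \<tau>'(3) unfolding Q_def by blast
      then have "env_precedes D (env_triv D (\<beta>, r + \<tau>')) (env_triv D (b, r + \<tau>))" by simp
      ultimately show ?thesis using env_precedes_trans by blast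
    qed
    moreover have "\<beta>' \<in> topspace (leaf_space D)" using \<beta>'(1) W(1) leaf_chart_subset_topspace by blast
    ultimately show ?thesis using \<beta>'(2) unfolding Q_def by blast
  qed
  obtain \<eta> where \<eta>: "0 < \<eta>" "\<eta> < \<epsilon>" using dense[OF \<epsilon>(1)] by blast
  \<comment> \<open>The minimum caps the parameter at \<open>pi\<close>, the limit up to which
    \<open>step\<close> applies.\<close>
  have reach: "\<exists>\<beta>. Q (min (real n * \<eta>) pi) \<beta>" for n
  proof (induction n)
    case 0
    have "Q 0 b" using top vertical_precedes by (simp add: Q_def great_circle_def u_def)
    then show ?case by (intro exI[of _ b]) simp
  next
    case (Suc n)
    then obtain \<beta> where \<beta>: "Q (min (real n * \<eta>) pi) \<beta>" by blast
    have suc: "real (Suc n) * \<eta> = real n * \<eta> + \<eta>" by (simp add: algebra_simps)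
    have "0 \<le> real n * \<eta>" using \<eta>(1) by simp
    then show ?case
      unfolding suc using \<eta> by (intro step[OF \<beta>]) (auto simp: min_def)
  qed
  obtain n where "pi < real n * \<eta>"
    using ex_less_of_nat_mult[OF \<eta>(1)] by blast
  then have "min (real n * \<eta>) pi = pi" by simp
  then obtain \<beta> where \<beta>: "Q pi \<beta>" using reach[of n] by auto
  \<comment> \<open>The conjugate pair: the times \<open>t + \<delta>\<close> over \<open>b\<close>
    and \<open>t + pi + \<delta>\<close> over \<open>\<beta>\<close> differ by \<open>pi\<close>,
    and the base points have antipodal images.\<close>
  have "t + pi + \<delta> \<in> fibre \<beta>" using fibre_between[OF t in_diamond[OF \<beta> order_refl]] .
  moreover have "t + \<delta> \<in> fibre b" 
    by (rule fibre_interval[OF t]) (use \<delta> pi_gt_zero in linarith)+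
  moreover have "leaf_dev D \<beta> = - leaf_dev D b" using \<beta> by (simp add: Q_def great_circle_def u_def)
  then have "env_conjugate (env_triv D (b, t + \<delta>)) (env_triv D (\<beta>, t + pi + \<delta>))"
    by (simp add: env_conjugate_def ein_conjugate_def ein_conjugation_def env_triv_def)
  ultimately show False using nc unfolding fibre_def by blast
qed

section \<open>Boundedness of the fibres and description by graphs\<close>

lemma bounded_fibre:
  assumes "CARD('n) \<ge> 2"
    and "globally_hyperbolic (subtopology (env_space D) \<Omega>) (curves_in \<Omega> (env_causal_curve D))"
    and "\<not> (\<exists>p\<in>\<Omega>. \<exists>q\<in>\<Omega>. env_conjugate p q)"
  shows "bounded (fibre b)"
proof (cases "fibre b = {}")
  case False
  then obtain t where t: "t \<in> fibre b" by blast
  have "fibre b \<subseteq> cball t (2 * pi)"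
  proof
    fix s assume s: "s \<in> fibre b"
    show "s \<in> cball t (2 * pi)"
      using fibre_length_le[OF assms t s] fibre_length_le[OF assms s t] by (simp add: dist_real_def)
  qed
  then show ?thesis using bounded_subset bounded_cball by blast
qed simp

lemma region_between_graphs:
  assumes bdd: "\<And>b. bounded (fibre b)"
  shows "\<Omega> = env_triv D ` {(x, t). x \<in> region_base \<and> Inf (fibre x) < t \<and> t < Sup (fibre x)}"
proof -
  have "{(x, t). t \<in> fibre x} = {(x, t). x \<in> region_base \<and> Inf (fibre x) < t \<and> t < Sup (fibre x)}"
  proof (rule Collect_cong, clarify)
    fix x t
    show "t \<in> fibre x \<longleftrightarrow> x \<in> region_base \<and> Inf (fibre x) < t \<and> t < Sup (fibre x)"
    proof (cases "x \<in> region_base")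
      case True
      have "t \<in> fibre x \<longleftrightarrow> t \<in> {Inf (fibre x)<..<Sup (fibre x)}"
        using fibre_eq_Inf_Sup[OF True bdd] by (rule arg_cong)
      then show ?thesis using True by simp
    next
      case False
      then show ?thesis by (simp add: region_base_def)
    qed
  qed
  then show ?thesis using region_eq by simp
qed

text \<open>Otherwise the open interval that equals the fibre would be empty.\<close>

lemma Inf_less_Sup_fibre:
  assumes "bounded (fibre b)" "b \<in> region_base"
  shows "Inf (fibre b) < Sup (fibre b)"
  using fibre_eq_Inf_Sup[OF assms(2,1)] assms(2) unfolding region_base_def
  by (metis (mono_tags, lifting) greaterThanLessThan_empty_iff linorder_not_le mem_Collect_eq)

end

theorem proposition10:
  fixes A :: "('v::{t2_space,second_countable_topology}, 'n::finite) chart set"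
    and g :: "('v, 'n) metric"
    and X :: "('v, 'n) vector_field"
    and D :: "'v \<Rightarrow> (real ^ 'n) \<times> real"
    and \<Omega> :: "(((real ^ 'n) \<times> real) \<times> 'v set) set"
  assumes "CARD('n) \<ge> 3"
    and "spacetime A g X"
    and "conformally_flat A g"
    and "simply_connected (UNIV :: 'v set)"
    and "globally_hyperbolic (euclidean :: 'v topology) (causal_curve A g X)"
    and "developing_map A g D"
    and "openin (env_space D) \<Omega>"
    and "causally_convex (env_causal_curve D) \<Omega>"
    and "globally_hyperbolic (subtopology (env_space D) \<Omega>) (curves_in \<Omega> (env_causal_curve D))"
    and "\<not> (\<exists>p\<in>\<Omega>. \<exists>q\<in>\<Omega>. env_conjugate p q)"
  shows "\<exists>U f\<^sub>p f\<^sub>m.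
    openin (leaf_space D) U \<and>
    one_lipschitz D U f\<^sub>p \<and> one_lipschitz D U f\<^sub>m \<and>
    \<Omega> = env_triv D ` {(x, t). x \<in> U \<and> f\<^sub>m x < t \<and> t < f\<^sub>p x} \<and>
    (\<forall>x\<in>U. f\<^sub>m x < f\<^sub>p x) \<and>
    (\<exists>h\<^sub>p h\<^sub>m. continuous_extension (leaf_space D) U f\<^sub>p h\<^sub>p \<and>
             continuous_extension (leaf_space D) U f\<^sub>m h\<^sub>m \<and>
             (\<forall>x\<in>leaf_space D frontier_of U. h\<^sub>p x = h\<^sub>m x))"
proof -
  \<comment> \<open>Extracts from the conformal local diffeomorphism the local homeomorphism that
    the locale asks for.\<close>
  have "\<exists>W. open W \<and> p \<in> W \<and> homeomorphism W (D ` W) D (inv_into W D) \<and>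
      openin (top_of_set Ein) (D ` W)" for p
  proof -
    obtain W where W: "open W" "p \<in> W" "conformal_diffeo_on A g W D Ein ein_form"
      using assms(6) unfolding developing_map_def by blast
    note diffeo = W(3)[unfolded conformal_diffeo_on_def]
    show ?thesis
      using W(1,2) diffeo[THEN conjunct1] diffeo[THEN conjunct2, THEN conjunct1] by blast
  qed
  then interpret causally_convex_region D \<Omega>
    using assms(7,8) by unfold_locales
  \<comment> \<open>Global hyperbolicity of \<open>\<Omega>\<close> and the absence of conjugate
    points enter here; this discharges the boundedness assumptions of the preceding lemmas.\<close>
  have bdd: "bounded (fibre b)" for b
    using assms(1) by (intro bounded_fibre assms(9,10)) simp
  obtain h k where hk: "continuous_extension (leaf_space D) region_base (\<lambda>b. Sup (fibre b)) h"
    "continuous_extension (leaf_space D) region_base (\<lambda>b. Inf (fibre b)) k"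
    "\<And>x. x \<in> leaf_space D frontier_of region_base \<Longrightarrow> h x = k x"
    by (rule Sup_Inf_extensions[OF bdd]) blast
  \<comment> \<open>The witnesses are \<open>region_base\<close>, with the suprema of the fibres as
    upper function and the infima as lower function.\<close>
  show ?thesis
  proof (intro exI conjI ballI)
    show "openin (leaf_space D) region_base" by (rule openin_region_base)
    show "one_lipschitz D region_base (\<lambda>b. Sup (fibre b))"
      "one_lipschitz D region_base (\<lambda>b. Inf (fibre b))"
      by (rule one_lipschitz_Sup_Inf[OF bdd])+
    show "\<Omega> = env_triv D ` {(x, t). x \<in> region_base \<and> Inf (fibre x) < t \<and> t < Sup (fibre x)}"
      by (rule region_between_graphs[OF bdd])
    show "Inf (fibre x) < Sup (fibre x)" if "x \<in> region_base" for x
      using Inf_less_Sup_fibre[OF bdd that] .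
  qed (rule hk; assumption)+
qed

end
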